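(* Over $\mathsf{RCA}_0$, the following are equivalent: (1) $\mathsf{ACA}_0$; (2) $\omega+\omega^*$ is linearizable.
   Context: $\mathsf{RCA}_0$ is the usual base system of reverse mathematics, a theory in the language of second-order arithmetic: the axioms of discretely ordered semirings for $\mathbb{N}$, induction for $\Sigma^0_1$ formulas, and comprehension for $\Delta^0_1$ predicates (formulas may contain number and set parameters). $\mathsf{ACA}_0$ is $\mathsf{RCA}_0$ plus comprehension for all arithmetical formulas. The following definitions are made in $\mathsf{RCA}_0$. A (countable) partial order is a set $P\subseteq\mathbb{N}$ with a set coding a partial order relation $\leq_P$ on $P$. A set $X$ is finite if $(\exists m)(\forall x\in X)(x<m)$. The partial order $P$ is $\omega+\omega^*$-like if every element of $P$ has finitely many predecessors or finitely many successors, where the predecessors of $x$ are the $y$ with $y<_P x$ and the successors of $x$ are the $y$ with $x<_P y$. A linear extension of $P$ is a linear order on the same set $P$ whose relation contains $\leq_P$. "$\omega+\omega^*$ is linearizable" is the statement that every $\omega+\omega^*$-like partial order has a linear extension which is also $\omega+\omega^*$-like. *)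

theory Defs
  imports Main
begin

section \<open>The language of second-order arithmetic\<close>

text \<open>
  Number variables and set variables are both named by strings but belong to different sorts:
  a string occurring in a term or bound by \<open>AllN\<close> is a number variable; a string to the right of
  \<open>Mem\<close> or bound by \<open>AllS\<close> is a set variable. Equality is primitive for numbers only.
\<close>

datatype trm = Var string | Zero (\<open>\<^bold>0\<close>) | One (\<open>\<^bold>1\<close>)
  | Plus trm trm (infixl \<open>\<^bold>+\<close> 85) | Times trm trm (infixl \<open>\<^bold>*\<close> 90)

datatype fm =
    Eq trm trm (infix \<open>\<^bold>=\<close> 75)
  | Less trm trm (infix \<open>\<^bold><\<close> 75)
  | Mem trm string (infix \<open>\<^bold>\<in>\<close> 75)
  | Falsum (\<open>\<^bold>\<bottom>\<close>)
  | Imp fm fm (infixr \<open>\<^bold>\<longrightarrow>\<close> 55)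
  | AllN string fm (\<open>\<^bold>\<forall>_./ _\<close> [60, 50] 50)
  | AllS string fm (\<open>\<^bold>\<forall>\<^sup>2_./ _\<close> [60, 50] 50)

abbreviation Neg :: "fm \<Rightarrow> fm" (\<open>\<^bold>\<not> _\<close> [70] 70)
  where "\<^bold>\<not> \<phi> \<equiv> \<phi> \<^bold>\<longrightarrow> \<^bold>\<bottom>"
abbreviation Or :: "fm \<Rightarrow> fm \<Rightarrow> fm" (infixr \<open>\<^bold>\<or>\<close> 60)
  where "\<phi> \<^bold>\<or> \<psi> \<equiv> \<^bold>\<not> \<phi> \<^bold>\<longrightarrow> \<psi>"
abbreviation And :: "fm \<Rightarrow> fm \<Rightarrow> fm" (infixr \<open>\<^bold>\<and>\<close> 65)
  where "\<phi> \<^bold>\<and> \<psi> \<equiv> \<^bold>\<not> (\<phi> \<^bold>\<longrightarrow> \<^bold>\<not> \<psi>)"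
abbreviation Iff :: "fm \<Rightarrow> fm \<Rightarrow> fm" (infixr \<open>\<^bold>\<longleftrightarrow>\<close> 53)
  where "\<phi> \<^bold>\<longleftrightarrow> \<psi> \<equiv> (\<phi> \<^bold>\<longrightarrow> \<psi>) \<^bold>\<and> (\<psi> \<^bold>\<longrightarrow> \<phi>)"
abbreviation ExN :: "string \<Rightarrow> fm \<Rightarrow> fm" (\<open>\<^bold>\<exists>_./ _\<close> [60, 50] 50)
  where "\<^bold>\<exists>x. \<phi> \<equiv> \<^bold>\<not> (\<^bold>\<forall>x. \<^bold>\<not> \<phi>)"
abbreviation ExS :: "string \<Rightarrow> fm \<Rightarrow> fm" (\<open>\<^bold>\<exists>\<^sup>2_./ _\<close> [60, 50] 50)
  where "\<^bold>\<exists>\<^sup>2X. \<phi> \<equiv> \<^bold>\<not> (\<^bold>\<forall>\<^sup>2X. \<^bold>\<not> \<phi>)"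

fun vars :: "trm \<Rightarrow> string set" where
  "vars (Var x) = {x}"
| "vars \<^bold>0 = {}"
| "vars \<^bold>1 = {}"
| "vars (s \<^bold>+ t) = vars s \<union> vars t"
| "vars (s \<^bold>* t) = vars s \<union> vars t"

fun freeN :: "fm \<Rightarrow> string set" where
  "freeN (s \<^bold>= t) = vars s \<union> vars t"
| "freeN (s \<^bold>< t) = vars s \<union> vars t"
| "freeN (t \<^bold>\<in> X) = vars t"
| "freeN \<^bold>\<bottom> = {}"
| "freeN (\<phi> \<^bold>\<longrightarrow> \<psi>) = freeN \<phi> \<union> freeN \<psi>"
| "freeN (\<^bold>\<forall>x. \<phi>) = freeN \<phi> - {x}"
| "freeN (\<^bold>\<forall>\<^sup>2X. \<phi>) = freeN \<phi>"

fun freeS :: "fm \<Rightarrow> string set" where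
  "freeS (s \<^bold>= t) = {}"
| "freeS (s \<^bold>< t) = {}"
| "freeS (t \<^bold>\<in> X) = {X}"
| "freeS \<^bold>\<bottom> = {}"
| "freeS (\<phi> \<^bold>\<longrightarrow> \<psi>) = freeS \<phi> \<union> freeS \<psi>"
| "freeS (\<^bold>\<forall>x. \<phi>) = freeS \<phi>"
| "freeS (\<^bold>\<forall>\<^sup>2X. \<phi>) = freeS \<phi> - {X}"

fun substT :: "string \<Rightarrow> trm \<Rightarrow> trm \<Rightarrow> trm" where
  "substT x r (Var y) = (if y = x then r else Var y)"
| "substT x r \<^bold>0 = \<^bold>0"
| "substT x r \<^bold>1 = \<^bold>1"
| "substT x r (s \<^bold>+ t) = substT x r s \<^bold>+ substT x r t"
| "substT x r (s \<^bold>* t) = substT x r s \<^bold>* substT x r t"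

text \<open>
  \<open>substN x r \<phi>\<close> and \<open>substS X Y \<phi>\<close> replace the free occurrences of a variable without renaming
  bound variables; \<open>free_forN\<close> and \<open>free_forS\<close> say that this captures no variable.
\<close>

fun substN :: "string \<Rightarrow> trm \<Rightarrow> fm \<Rightarrow> fm" where
  "substN x r (s \<^bold>= t) = (substT x r s \<^bold>= substT x r t)"
| "substN x r (s \<^bold>< t) = (substT x r s \<^bold>< substT x r t)"
| "substN x r (t \<^bold>\<in> X) = (substT x r t \<^bold>\<in> X)"
| "substN x r \<^bold>\<bottom> = \<^bold>\<bottom>"
| "substN x r (\<phi> \<^bold>\<longrightarrow> \<psi>) = (substN x r \<phi> \<^bold>\<longrightarrow> substN x r \<psi>)"
| "substN x r (\<^bold>\<forall>y. \<phi>) = (if y = x then \<^bold>\<forall>y. \<phi> else \<^bold>\<forall>y. substN x r \<phi>)"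
| "substN x r (\<^bold>\<forall>\<^sup>2X. \<phi>) = (\<^bold>\<forall>\<^sup>2X. substN x r \<phi>)"

fun free_forN :: "trm \<Rightarrow> string \<Rightarrow> fm \<Rightarrow> bool" where
  "free_forN r x (\<phi> \<^bold>\<longrightarrow> \<psi>) \<longleftrightarrow> free_forN r x \<phi> \<and> free_forN r x \<psi>"
| "free_forN r x (\<^bold>\<forall>y. \<phi>) \<longleftrightarrow> x \<notin> freeN (\<^bold>\<forall>y. \<phi>) \<or> y \<notin> vars r \<and> free_forN r x \<phi>"
| "free_forN r x (\<^bold>\<forall>\<^sup>2X. \<phi>) \<longleftrightarrow> free_forN r x \<phi>"
| "free_forN r x _ \<longleftrightarrow> True"

fun substS :: "string \<Rightarrow> string \<Rightarrow> fm \<Rightarrow> fm" where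
  "substS X Y (s \<^bold>= t) = (s \<^bold>= t)"
| "substS X Y (s \<^bold>< t) = (s \<^bold>< t)"
| "substS X Y (t \<^bold>\<in> Z) = (t \<^bold>\<in> (if Z = X then Y else Z))"
| "substS X Y \<^bold>\<bottom> = \<^bold>\<bottom>"
| "substS X Y (\<phi> \<^bold>\<longrightarrow> \<psi>) = (substS X Y \<phi> \<^bold>\<longrightarrow> substS X Y \<psi>)"
| "substS X Y (\<^bold>\<forall>x. \<phi>) = (\<^bold>\<forall>x. substS X Y \<phi>)"
| "substS X Y (\<^bold>\<forall>\<^sup>2Z. \<phi>) = (if Z = X then \<^bold>\<forall>\<^sup>2Z. \<phi> else \<^bold>\<forall>\<^sup>2Z. substS X Y \<phi>)"

fun free_forS :: "string \<Rightarrow> string \<Rightarrow> fm \<Rightarrow> bool" where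
  "free_forS Y X (\<phi> \<^bold>\<longrightarrow> \<psi>) \<longleftrightarrow> free_forS Y X \<phi> \<and> free_forS Y X \<psi>"
| "free_forS Y X (\<^bold>\<forall>x. \<phi>) \<longleftrightarrow> free_forS Y X \<phi>"
| "free_forS Y X (\<^bold>\<forall>\<^sup>2Z. \<phi>) \<longleftrightarrow> X \<notin> freeS (\<^bold>\<forall>\<^sup>2Z. \<phi>) \<or> Z \<noteq> Y \<and> free_forS Y X \<phi>"
| "free_forS Y X _ \<longleftrightarrow> True"


section \<open>Provability\<close>

text \<open>
  A Hilbert calculus for classical two-sorted first-order logic with equality on numbers.
  The generalization rules apply to arbitrary theorems of \<open>T\<close>, so an open formula in \<open>T\<close>
  amounts to its universal closure; its free variables are the parameters of the axiom.
\<close>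

inductive provable :: "fm set \<Rightarrow> fm \<Rightarrow> bool" (infix \<open>\<turnstile>\<close> 45) for T :: "fm set" where
  Axiom: "\<phi> \<in> T \<Longrightarrow> T \<turnstile> \<phi>"
| Imp_K: "T \<turnstile> \<phi> \<^bold>\<longrightarrow> \<psi> \<^bold>\<longrightarrow> \<phi>"
| Imp_S: "T \<turnstile> (\<phi> \<^bold>\<longrightarrow> \<psi> \<^bold>\<longrightarrow> \<chi>) \<^bold>\<longrightarrow> (\<phi> \<^bold>\<longrightarrow> \<psi>) \<^bold>\<longrightarrow> \<phi> \<^bold>\<longrightarrow> \<chi>"
| Double_Neg: "T \<turnstile> \<^bold>\<not> \<^bold>\<not> \<phi> \<^bold>\<longrightarrow> \<phi>"
| InstN: "free_forN t x \<phi> \<Longrightarrow> T \<turnstile> (\<^bold>\<forall>x. \<phi>) \<^bold>\<longrightarrow> substN x t \<phi>"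
| InstS: "free_forS Y X \<phi> \<Longrightarrow> T \<turnstile> (\<^bold>\<forall>\<^sup>2X. \<phi>) \<^bold>\<longrightarrow> substS X Y \<phi>"
| DistN: "x \<notin> freeN \<phi> \<Longrightarrow> T \<turnstile> (\<^bold>\<forall>x. \<phi> \<^bold>\<longrightarrow> \<psi>) \<^bold>\<longrightarrow> \<phi> \<^bold>\<longrightarrow> (\<^bold>\<forall>x. \<psi>)"
| DistS: "X \<notin> freeS \<phi> \<Longrightarrow> T \<turnstile> (\<^bold>\<forall>\<^sup>2X. \<phi> \<^bold>\<longrightarrow> \<psi>) \<^bold>\<longrightarrow> \<phi> \<^bold>\<longrightarrow> (\<^bold>\<forall>\<^sup>2X. \<psi>)"
| Eq_Refl: "T \<turnstile> t \<^bold>= t"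
| Eq_Subst: "free_forN s x \<phi> \<Longrightarrow> free_forN t x \<phi> \<Longrightarrow>
    T \<turnstile> s \<^bold>= t \<^bold>\<longrightarrow> substN x s \<phi> \<^bold>\<longrightarrow> substN x t \<phi>"
| Modus_Ponens: "T \<turnstile> \<phi> \<^bold>\<longrightarrow> \<psi> \<Longrightarrow> T \<turnstile> \<phi> \<Longrightarrow> T \<turnstile> \<psi>"
| GenN: "T \<turnstile> \<phi> \<Longrightarrow> T \<turnstile> \<^bold>\<forall>x. \<phi>"
| GenS: "T \<turnstile> \<phi> \<Longrightarrow> T \<turnstile> \<^bold>\<forall>\<^sup>2X. \<phi>"

text \<open>
  A principle may be an axiom scheme, so a principle is given by a set of formulas. Here \<open>A\<close> and
  \<open>B\<close> are equivalent over \<open>T\<close> if \<open>T\<close> together with either of them proves all of the other.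
\<close>

definition equivalent_over :: "fm set \<Rightarrow> fm set \<Rightarrow> fm set \<Rightarrow> bool" where
  "equivalent_over T A B \<longleftrightarrow> (\<forall>\<phi>\<in>B. T \<union> A \<turnstile> \<phi>) \<and> (\<forall>\<phi>\<in>A. T \<union> B \<turnstile> \<phi>)"


section \<open>The systems RCA0 and ACA0\<close>

inductive Delta00 :: "fm \<Rightarrow> bool" where
  "Delta00 (s \<^bold>= t)"
| "Delta00 (s \<^bold>< t)"
| "Delta00 (t \<^bold>\<in> X)"
| "Delta00 \<^bold>\<bottom>"
| "Delta00 \<phi> \<Longrightarrow> Delta00 \<psi> \<Longrightarrow> Delta00 (\<phi> \<^bold>\<longrightarrow> \<psi>)"
| "Delta00 \<phi> \<Longrightarrow> x \<notin> vars t \<Longrightarrow> Delta00 (\<^bold>\<forall>x. Var x \<^bold>< t \<^bold>\<longrightarrow> \<phi>)"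
| "Delta00 \<phi> \<Longrightarrow> x \<notin> vars t \<Longrightarrow> Delta00 (\<^bold>\<exists>x. Var x \<^bold>< t \<^bold>\<and> \<phi>)"

definition Sigma01 :: "fm \<Rightarrow> bool" where
  "Sigma01 \<phi> \<longleftrightarrow> (\<exists>x \<theta>. Delta00 \<theta> \<and> \<phi> = (\<^bold>\<exists>x. \<theta>))"

definition Pi01 :: "fm \<Rightarrow> bool" where
  "Pi01 \<phi> \<longleftrightarrow> (\<exists>x \<theta>. Delta00 \<theta> \<and> \<phi> = (\<^bold>\<forall>x. \<theta>))"

fun arithmetical :: "fm \<Rightarrow> bool" where
  "arithmetical (\<phi> \<^bold>\<longrightarrow> \<psi>) \<longleftrightarrow> arithmetical \<phi> \<and> arithmetical \<psi>"
| "arithmetical (\<^bold>\<forall>x. \<phi>) \<longleftrightarrow> arithmetical \<phi>"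
| "arithmetical (\<^bold>\<forall>\<^sup>2X. \<phi>) \<longleftrightarrow> False"
| "arithmetical _ \<longleftrightarrow> True"

definition ordered_semiring_axioms :: "fm set" where
  "ordered_semiring_axioms = (let x = Var ''x''; y = Var ''y''; z = Var ''z'' in
    { (x \<^bold>+ y) \<^bold>+ z \<^bold>= x \<^bold>+ (y \<^bold>+ z),
      x \<^bold>+ y \<^bold>= y \<^bold>+ x,
      (x \<^bold>* y) \<^bold>* z \<^bold>= x \<^bold>* (y \<^bold>* z),
      x \<^bold>* y \<^bold>= y \<^bold>* x,
      x \<^bold>* (y \<^bold>+ z) \<^bold>= x \<^bold>* y \<^bold>+ x \<^bold>* z,
      x \<^bold>+ \<^bold>0 \<^bold>= x,
      x \<^bold>* \<^bold>0 \<^bold>= \<^bold>0,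
      x \<^bold>* \<^bold>1 \<^bold>= x,
      x \<^bold>< y \<^bold>\<and> y \<^bold>< z \<^bold>\<longrightarrow> x \<^bold>< z,
      \<^bold>\<not> x \<^bold>< x,
      x \<^bold>< y \<^bold>\<or> x \<^bold>= y \<^bold>\<or> y \<^bold>< x,
      x \<^bold>< y \<^bold>\<longrightarrow> x \<^bold>+ z \<^bold>< y \<^bold>+ z,
      \<^bold>0 \<^bold>< z \<^bold>\<and> x \<^bold>< y \<^bold>\<longrightarrow> x \<^bold>* z \<^bold>< y \<^bold>* z,
      x \<^bold>< y \<^bold>\<longrightarrow> (\<^bold>\<exists>''z''. x \<^bold>+ z \<^bold>= y),
      \<^bold>0 \<^bold>< \<^bold>1,
      \<^bold>0 \<^bold>< x \<^bold>\<longrightarrow> \<^bold>1 \<^bold>< x \<^bold>\<or> \<^bold>1 \<^bold>= x,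
      \<^bold>0 \<^bold>< x \<^bold>\<or> \<^bold>0 \<^bold>= x })"

text \<open>
  In the substitution instances below no capture is possible: a free occurrence of \<open>x\<close> in \<open>\<phi>\<close> is
  not in the scope of a quantifier binding \<open>x\<close>.
\<close>

definition Sigma01_induction :: "fm set" where
  "Sigma01_induction =
    {substN x \<^bold>0 \<phi> \<^bold>\<and> (\<^bold>\<forall>x. \<phi> \<^bold>\<longrightarrow> substN x (Var x \<^bold>+ \<^bold>1) \<phi>) \<^bold>\<longrightarrow> (\<^bold>\<forall>x. \<phi>) | x \<phi>. Sigma01 \<phi>}"

definition Delta01_comprehension :: "fm set" where
  "Delta01_comprehension =
    {(\<^bold>\<forall>x. \<phi> \<^bold>\<longleftrightarrow> \<psi>) \<^bold>\<longrightarrow> (\<^bold>\<exists>\<^sup>2X. \<^bold>\<forall>x. Var x \<^bold>\<in> X \<^bold>\<longleftrightarrow> \<phi>) | x X \<phi> \<psi>.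
      Sigma01 \<phi> \<and> Pi01 \<psi> \<and> X \<notin> freeS \<phi>}"

definition arithmetical_comprehension :: "fm set" where
  "arithmetical_comprehension =
    {\<^bold>\<exists>\<^sup>2X. \<^bold>\<forall>x. Var x \<^bold>\<in> X \<^bold>\<longleftrightarrow> \<phi> | x X \<phi>. arithmetical \<phi> \<and> X \<notin> freeS \<phi>}"

definition RCA0 :: "fm set" where
  "RCA0 = ordered_semiring_axioms \<union> Sigma01_induction \<union> Delta01_comprehension"

definition ACA0 :: "fm set" where
  "ACA0 = RCA0 \<union> arithmetical_comprehension"


section \<open>Partial orders and linear extensions in second-order arithmetic\<close>

text \<open>The pair \<open>(s, t)\<close> is coded by \<open>(s + t)\<^sup>2 + s\<close>, which is injective.\<close>

definition pair :: "trm \<Rightarrow> trm \<Rightarrow> trm" where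
  "pair s t = (s \<^bold>+ t) \<^bold>* (s \<^bold>+ t) \<^bold>+ s"

definition leq :: "string \<Rightarrow> trm \<Rightarrow> trm \<Rightarrow> fm" where
  "leq R s t = (pair s t \<^bold>\<in> R)"

definition lt :: "string \<Rightarrow> trm \<Rightarrow> trm \<Rightarrow> fm" where
  "lt R s t = (leq R s t \<^bold>\<and> \<^bold>\<not> s \<^bold>= t)"

text \<open>An order on the set \<open>P\<close> is coded by a set \<open>R\<close> of (codes of) pairs of elements of \<open>P\<close>.\<close>

definition partial_order :: "string \<Rightarrow> string \<Rightarrow> fm" where
  "partial_order P R = (let x = Var ''x''; y = Var ''y''; z = Var ''z'' in
    (\<^bold>\<forall>''z''. z \<^bold>\<in> R \<^bold>\<longrightarrow> (\<^bold>\<exists>''x''. \<^bold>\<exists>''y''. x \<^bold>\<in> P \<^bold>\<and> y \<^bold>\<in> P \<^bold>\<and> z \<^bold>= pair x y)) \<^bold>\<and>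
    (\<^bold>\<forall>''x''. x \<^bold>\<in> P \<^bold>\<longrightarrow> leq R x x) \<^bold>\<and>
    (\<^bold>\<forall>''x''. \<^bold>\<forall>''y''. leq R x y \<^bold>\<and> leq R y x \<^bold>\<longrightarrow> x \<^bold>= y) \<^bold>\<and>
    (\<^bold>\<forall>''x''. \<^bold>\<forall>''y''. \<^bold>\<forall>''z''. leq R x y \<^bold>\<and> leq R y z \<^bold>\<longrightarrow> leq R x z))"

definition linear_order :: "string \<Rightarrow> string \<Rightarrow> fm" where
  "linear_order P R = (let x = Var ''x''; y = Var ''y'' in
    partial_order P R \<^bold>\<and>
    (\<^bold>\<forall>''x''. \<^bold>\<forall>''y''. x \<^bold>\<in> P \<^bold>\<and> y \<^bold>\<in> P \<^bold>\<longrightarrow> leq R x y \<^bold>\<or> leq R y x))"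

text \<open>\<open>finitely_many y \<phi>\<close> says that \<open>{y. \<phi>}\<close> is finite, i.e. bounded; \<open>\<phi>\<close> must not contain \<open>m\<close> free.\<close>

definition finitely_many :: "string \<Rightarrow> fm \<Rightarrow> fm" where
  "finitely_many y \<phi> = (\<^bold>\<exists>''m''. \<^bold>\<forall>y. \<phi> \<^bold>\<longrightarrow> Var y \<^bold>< Var ''m'')"

definition omega_omega_star_like :: "string \<Rightarrow> string \<Rightarrow> fm" where
  "omega_omega_star_like P R = (let x = Var ''x''; y = Var ''y'' in
    \<^bold>\<forall>''x''. x \<^bold>\<in> P \<^bold>\<longrightarrow> finitely_many ''y'' (lt R y x) \<^bold>\<or> finitely_many ''y'' (lt R x y))"

definition linear_extension :: "string \<Rightarrow> string \<Rightarrow> string \<Rightarrow> fm" where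
  "linear_extension P R L = (let x = Var ''x''; y = Var ''y'' in
    linear_order P L \<^bold>\<and> (\<^bold>\<forall>''x''. \<^bold>\<forall>''y''. leq R x y \<^bold>\<longrightarrow> leq L x y))"

definition omega_omega_star_linearizable :: fm where
  "omega_omega_star_linearizable =
    (\<^bold>\<forall>\<^sup>2''P''. \<^bold>\<forall>\<^sup>2''R''. partial_order ''P'' ''R'' \<^bold>\<and> omega_omega_star_like ''P'' ''R'' \<^bold>\<longrightarrow>
      (\<^bold>\<exists>\<^sup>2''L''. linear_extension ''P'' ''R'' ''L'' \<^bold>\<and> omega_omega_star_like ''P'' ''L''))"

end

theory Submission
  imports Defs "HOL-Library.Countable_Set"
begin

text \<open>
  Neither implication is derived inside the Hilbert calculus. The calculus is complete
  (\<open>completeness\<close>), so it suffices to argue about an arbitrary structure in which \<open>RCA0\<close> and the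
  respective principle hold. Its numbers may be nonstandard and its family of sets may be small: the
  only induction available is for sets of the structure, and every set that is used has to be
  shown to belong to it.

  From ACA0 to linearizability. Let \<open>A\<close> consist of the points of the partial order with finitely
  many predecessors, and let \<open>B\<close> be the rest, whose points have finitely many successors. \<open>A\<close> is
  closed downwards, so all of \<open>A\<close> may be put below all of \<open>B\<close>, and it remains to extend the order on
  \<open>A\<close> to one in which initial segments are finite; \<open>B\<close> is treated as \<open>A\<close> with the order reversed.
  On \<open>A\<close> one compares the sets of upper bounds lexicographically: \<open>a\<close> comes before \<open>b\<close> if the least
  element of \<open>A\<close> at which the two sets differ is an upper bound of \<open>a\<close>. Whatever comes before \<open>a\<close> is
  then below one of the finitely many elements of \<open>A\<close> that do not exceed the number \<open>a\<close>, so initial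
  segments are finite (\<open>lex_bounded\<close>). The definition of this order is
  arithmetical, so comprehension yields it at once.

  From linearizability to ACA0. The key is \<open>projection_in_Sets\<close>: a set \<open>K\<close> given by
  \<open>\<exists>s. (s, n) \<in> X\<close> exists. A partial order computable from \<open>X\<close> is built that contains points \<open>x_n\<close> and \<open>y_n\<close>,
  incomparable with each other, together with points that are added in stages. While \<open>n\<close> has not
  been enumerated, each stage puts a new point below \<open>x_n\<close> and a new point above \<open>y_n\<close>; once \<open>n\<close>
  has been enumerated, each stage puts a new point above \<open>x_n\<close> and a new point below \<open>y_n\<close>. If \<open>n\<close>
  is never enumerated, then \<open>x_n\<close> has infinitely many predecessors and \<open>y_n\<close> infinitely many
  successors; otherwise it is the other way round. In a linear extension \<open>L\<close> of type
  \<open>\<omega> + \<omega>\<^sup>*\<close> a point with infinitely many successors must lie before a point with infinitely many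
  predecessors. Hence \<open>n \<in> K\<close> exactly when \<open>x_n\<close> lies before \<open>y_n\<close> in \<open>L\<close>, which is a decidable
  question about \<open>L\<close>. Projections handle one quantifier; coding the free variables of a formula
  into a single number, one removes all number quantifiers by induction on the formula
  (\<open>represented_arithmetical\<close>).
\<close>

section \<open>Variables and substitution\<close>

text \<open>
  Fresh variables have to avoid the bound occurrences as well as the free ones, because substitution
  does not rename: a variable outside \<open>allN \<phi>\<close> or \<open>allS \<phi>\<close> can be put into \<open>\<phi>\<close> for another
  variable, and taken out again, without capture.
\<close>

fun allN :: "fm \<Rightarrow> string set" where
  "allN (s \<^bold>= t) = vars s \<union> vars t"
| "allN (s \<^bold>< t) = vars s \<union> vars t"
| "allN (t \<^bold>\<in> X) = vars t"
| "allN \<^bold>\<bottom> = {}"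
| "allN (\<phi> \<^bold>\<longrightarrow> \<psi>) = allN \<phi> \<union> allN \<psi>"
| "allN (\<^bold>\<forall>x. \<phi>) = insert x (allN \<phi>)"
| "allN (\<^bold>\<forall>\<^sup>2X. \<phi>) = allN \<phi>"

fun allS :: "fm \<Rightarrow> string set" where
  "allS (s \<^bold>= t) = {}"
| "allS (s \<^bold>< t) = {}"
| "allS (t \<^bold>\<in> X) = {X}"
| "allS \<^bold>\<bottom> = {}"
| "allS (\<phi> \<^bold>\<longrightarrow> \<psi>) = allS \<phi> \<union> allS \<psi>"
| "allS (\<^bold>\<forall>x. \<phi>) = allS \<phi>"
| "allS (\<^bold>\<forall>\<^sup>2X. \<phi>) = insert X (allS \<phi>)"

lemma finite_vars [simp]: "finite (vars t)"
  by (induction t) auto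

lemma finite_allN [simp]: "finite (allN \<phi>)"
  by (induction \<phi>) auto

lemma finite_allS [simp]: "finite (allS \<phi>)"
  by (induction \<phi>) auto

lemma not_freeN: "y \<notin> allN \<phi> \<Longrightarrow> y \<notin> freeN \<phi>"
  by (induction \<phi>) auto

lemma not_freeS: "Y \<notin> allS \<phi> \<Longrightarrow> Y \<notin> freeS \<phi>"
  by (induction \<phi>) auto

lemma fresh_string: "finite F \<Longrightarrow> \<exists>y::string. y \<notin> F"
  by (rule ex_new_if_finite[OF infinite_UNIV_listI])

lemma substT_fresh [simp]: "x \<notin> vars t \<Longrightarrow> substT x r t = t"
  by (induction t) auto

lemma substT_self [simp]: "substT x (Var x) t = t"
  by (induction t) auto

lemma substT_back [simp]: "y \<notin> vars t \<Longrightarrow> substT y (Var x) (substT x (Var y) t) = t"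
  by (induction t) auto

lemma vars_substT: "vars (substT x r t) = (if x \<in> vars t then vars t - {x} \<union> vars r else vars t)"
  by (induction t) auto

lemma substN_fresh [simp]: "x \<notin> freeN \<phi> \<Longrightarrow> substN x r \<phi> = \<phi>"
  by (induction \<phi>) auto

lemma substS_fresh [simp]: "X \<notin> freeS \<phi> \<Longrightarrow> substS X Y \<phi> = \<phi>"
  by (induction \<phi>) auto

lemma substN_self [simp]: "substN x (Var x) \<phi> = \<phi>"
  by (induction \<phi>) auto

lemma substS_self [simp]: "substS X X \<phi> = \<phi>"
  by (induction \<phi>) auto

lemma free_forN_self: "free_forN (Var x) x \<phi>"
  by (induction \<phi>) auto

lemma free_forS_self: "free_forS X X \<phi>"
  by (induction \<phi>) auto

lemma free_forN_fresh: "y \<notin> allN \<phi> \<Longrightarrow> free_forN (Var y) x \<phi>"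
  by (induction \<phi>) auto

lemma free_forS_fresh: "Y \<notin> allS \<phi> \<Longrightarrow> free_forS Y X \<phi>"
  by (induction \<phi>) auto

lemma substN_back: "y \<notin> allN \<phi> \<Longrightarrow> substN y (Var x) (substN x (Var y) \<phi>) = \<phi>"
  by (induction \<phi>) (auto simp: not_freeN)

lemma substS_back: "Y \<notin> allS \<phi> \<Longrightarrow> substS Y X (substS X Y \<phi>) = \<phi>"
  by (induction \<phi>) (auto simp: not_freeS)

lemma free_forN_back: "y \<notin> allN \<phi> \<Longrightarrow> free_forN (Var x) y (substN x (Var y) \<phi>)"
  by (induction \<phi>) (auto simp: not_freeN)

lemma free_forS_back: "Y \<notin> allS \<phi> \<Longrightarrow> free_forS X Y (substS X Y \<phi>)"
  by (induction \<phi>) (auto simp: not_freeS)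

lemma not_free_substN: "x \<noteq> y \<Longrightarrow> x \<notin> freeN (substN x (Var y) \<phi>)"
  by (induction \<phi>) (auto simp: vars_substT split: if_splits)

lemma not_free_substS: "X \<noteq> Y \<Longrightarrow> X \<notin> freeS (substS X Y \<phi>)"
  by (induction \<phi>) auto

lemma size_substN [simp]: "size (substN x r \<phi>) = size \<phi>"
  by (induction \<phi>) auto

lemma size_substS [simp]: "size (substS X Y \<phi>) = size \<phi>"
  by (induction \<phi>) auto

section \<open>Derivations from hypotheses\<close>

text \<open>
  The hypotheses \<open>\<Gamma>\<close> are kept apart from the theory \<open>T\<close> because generalization may be applied to
  theorems of \<open>T\<close> but not to hypotheses. For this relation the deduction theorem holds without a
  condition on free variables.
\<close>

inductive derives :: "fm set \<Rightarrow> fm set \<Rightarrow> fm \<Rightarrow> bool" for T \<Gamma> where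
  Hyp: "\<phi> \<in> \<Gamma> \<Longrightarrow> derives T \<Gamma> \<phi>"
| Thm: "T \<turnstile> \<phi> \<Longrightarrow> derives T \<Gamma> \<phi>"
| MP: "derives T \<Gamma> (\<phi> \<^bold>\<longrightarrow> \<psi>) \<Longrightarrow> derives T \<Gamma> \<phi> \<Longrightarrow> derives T \<Gamma> \<psi>"

lemma Imp_refl: "T \<turnstile> \<phi> \<^bold>\<longrightarrow> \<phi>"
  by (rule Modus_Ponens[OF Modus_Ponens[OF Imp_S[where \<psi> = "\<phi> \<^bold>\<longrightarrow> \<phi>"] Imp_K] Imp_K])

lemma Imp_const: "T \<turnstile> \<psi> \<Longrightarrow> T \<turnstile> \<phi> \<^bold>\<longrightarrow> \<psi>"
  by (rule Modus_Ponens[OF Imp_K])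

lemma Imp_trans: "T \<turnstile> \<phi> \<^bold>\<longrightarrow> \<psi> \<Longrightarrow> T \<turnstile> \<psi> \<^bold>\<longrightarrow> \<chi> \<Longrightarrow> T \<turnstile> \<phi> \<^bold>\<longrightarrow> \<chi>"
  by (rule Modus_Ponens[OF Modus_Ponens[OF Imp_S Imp_const]])

lemma derives_mono: "derives T \<Gamma> \<phi> \<Longrightarrow> \<Gamma> \<subseteq> \<Delta> \<Longrightarrow> derives T \<Delta> \<phi>"
  by (induction rule: derives.induct) (auto intro: derives.intros)

lemma deduction: "derives T (insert \<psi> \<Gamma>) \<phi> \<Longrightarrow> derives T \<Gamma> (\<psi> \<^bold>\<longrightarrow> \<phi>)"
proof (induction rule: derives.induct)
  case (Hyp \<phi>)
  then show ?case
  proof (cases "\<phi> = \<psi>")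
    case True
    then show ?thesis by (simp add: Imp_refl derives.Thm)
  next
    case False
    with Hyp have "derives T \<Gamma> \<phi>" by (auto intro: derives.Hyp)
    then show ?thesis by (rule derives.MP[OF derives.Thm[OF Imp_K]])
  qed
next
  case (Thm \<phi>)
  then show ?case by (intro derives.Thm Imp_const)
next
  case (MP \<phi> \<chi>)
  then show ?case by (blast intro: derives.MP[OF derives.MP[OF derives.Thm[OF Imp_S]]])
qed

lemma derives_empty: "derives T {} \<phi> \<Longrightarrow> T \<turnstile> \<phi>"
  by (induction rule: derives.induct) (auto intro: Modus_Ponens)

lemma provable_instN: "T \<turnstile> \<phi> \<Longrightarrow> free_forN t x \<phi> \<Longrightarrow> T \<turnstile> substN x t \<phi>"
  by (rule Modus_Ponens[OF InstN GenN])

lemma All_Imp_distN: "T \<turnstile> (\<^bold>\<forall>x. \<phi> \<^bold>\<longrightarrow> \<psi>) \<^bold>\<longrightarrow> (\<^bold>\<forall>x. \<phi>) \<^bold>\<longrightarrow> (\<^bold>\<forall>x. \<psi>)"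
proof -
  have inst: "T \<turnstile> (\<^bold>\<forall>x. \<chi>) \<^bold>\<longrightarrow> \<chi>" for \<chi>
    using InstN[OF free_forN_self, of T x \<chi>] by simp
  have "derives T {\<^bold>\<forall>x. \<phi>, \<^bold>\<forall>x. \<phi> \<^bold>\<longrightarrow> \<psi>} \<psi>"
    by (rule derives.MP; rule derives.MP[OF derives.Thm[OF inst]]; rule derives.Hyp) auto
  then have "T \<turnstile> (\<^bold>\<forall>x. \<phi> \<^bold>\<longrightarrow> \<psi>) \<^bold>\<longrightarrow> (\<^bold>\<forall>x. \<phi>) \<^bold>\<longrightarrow> \<psi>"
    by (intro derives_empty deduction)
  then have "T \<turnstile> (\<^bold>\<forall>x. \<phi> \<^bold>\<longrightarrow> \<psi>) \<^bold>\<longrightarrow> (\<^bold>\<forall>x. (\<^bold>\<forall>x. \<phi>) \<^bold>\<longrightarrow> \<psi>)"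
    by (intro Modus_Ponens[OF DistN] GenN) auto
  moreover have "T \<turnstile> (\<^bold>\<forall>x. (\<^bold>\<forall>x. \<phi>) \<^bold>\<longrightarrow> \<psi>) \<^bold>\<longrightarrow> (\<^bold>\<forall>x. \<phi>) \<^bold>\<longrightarrow> (\<^bold>\<forall>x. \<psi>)"
    by (rule DistN) auto
  ultimately show ?thesis
    by (rule Imp_trans)
qed

lemma All_Imp_distS: "T \<turnstile> (\<^bold>\<forall>\<^sup>2X. \<phi> \<^bold>\<longrightarrow> \<psi>) \<^bold>\<longrightarrow> (\<^bold>\<forall>\<^sup>2X. \<phi>) \<^bold>\<longrightarrow> (\<^bold>\<forall>\<^sup>2X. \<psi>)"
proof -
  have inst: "T \<turnstile> (\<^bold>\<forall>\<^sup>2X. \<chi>) \<^bold>\<longrightarrow> \<chi>" for \<chi>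
    using InstS[OF free_forS_self, of T X \<chi>] by simp
  have "derives T {\<^bold>\<forall>\<^sup>2X. \<phi>, \<^bold>\<forall>\<^sup>2X. \<phi> \<^bold>\<longrightarrow> \<psi>} \<psi>"
    by (rule derives.MP; rule derives.MP[OF derives.Thm[OF inst]]; rule derives.Hyp) auto
  then have "T \<turnstile> (\<^bold>\<forall>\<^sup>2X. \<phi> \<^bold>\<longrightarrow> \<psi>) \<^bold>\<longrightarrow> (\<^bold>\<forall>\<^sup>2X. \<phi>) \<^bold>\<longrightarrow> \<psi>"
    by (intro derives_empty deduction)
  then have "T \<turnstile> (\<^bold>\<forall>\<^sup>2X. \<phi> \<^bold>\<longrightarrow> \<psi>) \<^bold>\<longrightarrow> (\<^bold>\<forall>\<^sup>2X. (\<^bold>\<forall>\<^sup>2X. \<phi>) \<^bold>\<longrightarrow> \<psi>)"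
    by (intro Modus_Ponens[OF DistS] GenS) auto
  moreover have "T \<turnstile> (\<^bold>\<forall>\<^sup>2X. (\<^bold>\<forall>\<^sup>2X. \<phi>) \<^bold>\<longrightarrow> \<psi>) \<^bold>\<longrightarrow> (\<^bold>\<forall>\<^sup>2X. \<phi>) \<^bold>\<longrightarrow> (\<^bold>\<forall>\<^sup>2X. \<psi>)"
    by (rule DistS) auto
  ultimately show ?thesis
    by (rule Imp_trans)
qed

text \<open>
  Generalization over a variable that is not free in the hypotheses is admissible: it commutes with
  modus ponens by \<open>All_Imp_distN\<close>.
\<close>

lemma derives_GenN:
  assumes "derives T \<Gamma> \<phi>" "\<And>\<psi>. \<psi> \<in> \<Gamma> \<Longrightarrow> x \<notin> freeN \<psi>"
  shows "derives T \<Gamma> (\<^bold>\<forall>x. \<phi>)"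
  using assms(1)
proof (induction rule: derives.induct)
  case (Hyp \<phi>)
  then have "T \<turnstile> \<phi> \<^bold>\<longrightarrow> (\<^bold>\<forall>x. \<phi>)"
    by (intro Modus_Ponens[OF DistN[OF assms(2)]] GenN Imp_refl)
  then show ?case by (rule derives.MP[OF derives.Thm derives.Hyp[OF Hyp]])
next
  case (Thm \<phi>)
  then show ?case by (intro derives.Thm GenN)
next
  case (MP \<phi> \<psi>)
  show ?case by (rule derives.MP[OF derives.MP[OF derives.Thm[OF All_Imp_distN] MP.IH(1)] MP.IH(2)])
qed

lemma derives_GenS:
  assumes "derives T \<Gamma> \<phi>" "\<And>\<psi>. \<psi> \<in> \<Gamma> \<Longrightarrow> X \<notin> freeS \<psi>"
  shows "derives T \<Gamma> (\<^bold>\<forall>\<^sup>2X. \<phi>)"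
  using assms(1)
proof (induction rule: derives.induct)
  case (Hyp \<phi>)
  then have "T \<turnstile> \<phi> \<^bold>\<longrightarrow> (\<^bold>\<forall>\<^sup>2X. \<phi>)"
    by (intro Modus_Ponens[OF DistS[OF assms(2)]] GenS Imp_refl)
  then show ?case by (rule derives.MP[OF derives.Thm derives.Hyp[OF Hyp]])
next
  case (Thm \<phi>)
  then show ?case by (intro derives.Thm GenS)
next
  case (MP \<phi> \<psi>)
  show ?case by (rule derives.MP[OF derives.MP[OF derives.Thm[OF All_Imp_distS] MP.IH(1)] MP.IH(2)])
qed

lemma derives_contradiction: "derives T (insert (\<^bold>\<not> \<phi>) \<Gamma>) \<^bold>\<bottom> \<Longrightarrow> derives T \<Gamma> \<phi>"
  by (rule derives.MP[OF derives.Thm[OF Double_Neg] deduction])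

text \<open>
  Generalize over the fresh \<open>y\<close>, which stands for an arbitrary number, and then rename it back
  to \<open>x\<close>; the renaming is legitimate because \<open>y\<close> occurs nowhere in \<open>\<phi>\<close>.
\<close>

lemma derives_renameN:
  assumes "derives T \<Gamma> (substN x (Var y) \<phi>)" "y \<notin> allN \<phi>" "\<And>\<psi>. \<psi> \<in> \<Gamma> \<Longrightarrow> y \<notin> allN \<psi>" "x \<noteq> y"
  shows "derives T \<Gamma> (\<^bold>\<forall>x. \<phi>)"
proof -
  have "derives T \<Gamma> (\<^bold>\<forall>y. substN x (Var y) \<phi>)"
    using assms by (intro derives_GenN) (auto simp: not_freeN)
  moreover have "T \<turnstile> (\<^bold>\<forall>y. substN x (Var y) \<phi>) \<^bold>\<longrightarrow> \<phi>"
    using InstN[OF free_forN_back, of y \<phi> T x] assms by (simp add: substN_back)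
  then have "T \<turnstile> (\<^bold>\<forall>y. substN x (Var y) \<phi>) \<^bold>\<longrightarrow> (\<^bold>\<forall>x. \<phi>)"
    using assms(4) by (intro Modus_Ponens[OF DistN] GenN) (auto dest: not_free_substN)
  ultimately show ?thesis by (auto intro: derives.MP[OF derives.Thm])
qed

lemma derives_renameS:
  assumes "derives T \<Gamma> (substS X Y \<phi>)" "Y \<notin> allS \<phi>" "\<And>\<psi>. \<psi> \<in> \<Gamma> \<Longrightarrow> Y \<notin> allS \<psi>" "X \<noteq> Y"
  shows "derives T \<Gamma> (\<^bold>\<forall>\<^sup>2X. \<phi>)"
proof -
  have "derives T \<Gamma> (\<^bold>\<forall>\<^sup>2Y. substS X Y \<phi>)"
    using assms by (intro derives_GenS) (auto simp: not_freeS)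
  moreover have "T \<turnstile> (\<^bold>\<forall>\<^sup>2Y. substS X Y \<phi>) \<^bold>\<longrightarrow> \<phi>"
    using InstS[OF free_forS_back, of Y \<phi> T X] assms by (simp add: substS_back)
  then have "T \<turnstile> (\<^bold>\<forall>\<^sup>2Y. substS X Y \<phi>) \<^bold>\<longrightarrow> (\<^bold>\<forall>\<^sup>2X. \<phi>)"
    using assms(4) by (intro Modus_Ponens[OF DistS] GenS) (auto dest: not_free_substS)
  ultimately show ?thesis by (auto intro: derives.MP[OF derives.Thm])
qed

abbreviation consistent :: "fm set \<Rightarrow> fm set \<Rightarrow> bool" where
  "consistent T \<Gamma> \<equiv> \<not> derives T \<Gamma> \<^bold>\<bottom>"

section \<open>Henkin sets\<close>

text \<open>
  The Henkin constants are the variables themselves. That a witness is fresh for the formula that it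
  witnesses will provide, for every term, a variable equal to it outside any given finite set
  (\<open>alias_number\<close>), and this replaces the renaming of bound variables in the truth lemma.
\<close>

locale henkin_set =
  fixes T \<Gamma> :: "fm set"
  assumes consistent: "consistent T \<Gamma>"
    and complete: "\<phi> \<in> \<Gamma> \<or> \<^bold>\<not> \<phi> \<in> \<Gamma>"
    and witnessN: "(\<^bold>\<forall>x. \<phi>) \<notin> \<Gamma> \<Longrightarrow> \<exists>y. y \<notin> allN \<phi> \<and> substN x (Var y) \<phi> \<notin> \<Gamma>"
    and witnessS: "(\<^bold>\<forall>\<^sup>2X. \<phi>) \<notin> \<Gamma> \<Longrightarrow> \<exists>Y. Y \<notin> allS \<phi> \<and> substS X Y \<phi> \<notin> \<Gamma>"

text \<open>
  If the negated instance at a fresh \<open>y\<close> were refutable, then \<open>y\<close> could be generalized, contradicting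
  the hypothesis that the universal formula fails. Only finitely many variables are in use.
\<close>

lemma consistent_witnessN:
  assumes "finite \<Gamma>" "consistent T \<Gamma>" "\<^bold>\<not> (\<^bold>\<forall>x. \<phi>) \<in> \<Gamma>"
  obtains y where "y \<notin> allN \<phi>" "consistent T (insert (\<^bold>\<not> substN x (Var y) \<phi>) \<Gamma>)"
proof -
  have "finite (insert x (allN \<phi>) \<union> \<Union>(allN ` \<Gamma>))"
    using assms(1) by simp
  then obtain y where y: "y \<notin> insert x (allN \<phi>) \<union> \<Union>(allN ` \<Gamma>)"
    using fresh_string by blast
  have "consistent T (insert (\<^bold>\<not> substN x (Var y) \<phi>) \<Gamma>)"
  proof
    assume "derives T (insert (\<^bold>\<not> substN x (Var y) \<phi>) \<Gamma>) \<^bold>\<bottom>"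
    then have "derives T \<Gamma> (\<^bold>\<forall>x. \<phi>)"
      using y by (intro derives_renameN[OF derives_contradiction]) auto
    then show False using derives.MP[OF derives.Hyp[OF assms(3)]] assms(2) by simp
  qed
  with y show thesis by (intro that) auto
qed

lemma consistent_witnessS:
  assumes "finite \<Gamma>" "consistent T \<Gamma>" "\<^bold>\<not> (\<^bold>\<forall>\<^sup>2X. \<phi>) \<in> \<Gamma>"
  obtains Y where "Y \<notin> allS \<phi>" "consistent T (insert (\<^bold>\<not> substS X Y \<phi>) \<Gamma>)"
proof -
  have "finite (insert X (allS \<phi>) \<union> \<Union>(allS ` \<Gamma>))"
    using assms(1) by simp
  then obtain Y where Y: "Y \<notin> insert X (allS \<phi>) \<union> \<Union>(allS ` \<Gamma>)"
    using fresh_string by blast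
  have "consistent T (insert (\<^bold>\<not> substS X Y \<phi>) \<Gamma>)"
  proof
    assume "derives T (insert (\<^bold>\<not> substS X Y \<phi>) \<Gamma>) \<^bold>\<bottom>"
    then have "derives T \<Gamma> (\<^bold>\<forall>\<^sup>2X. \<phi>)"
      using Y by (intro derives_renameS[OF derives_contradiction]) auto
    then show False using derives.MP[OF derives.Hyp[OF assms(3)]] assms(2) by simp
  qed
  with Y show thesis by (intro that) auto
qed

text \<open>
  What one stage of the construction has to achieve for a formula. Negations are used in place of
  nonmembership, so that the condition persists when \<open>\<Delta>\<close> grows.
\<close>

fun decided :: "fm set \<Rightarrow> fm \<Rightarrow> bool" where
  "decided \<Delta> (\<^bold>\<forall>x. \<phi>) \<longleftrightarrow> (\<^bold>\<forall>x. \<phi>) \<in> \<Delta> \<or> \<^bold>\<not> (\<^bold>\<forall>x. \<phi>) \<in> \<Delta> \<and>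
    (\<exists>y. y \<notin> allN \<phi> \<and> \<^bold>\<not> substN x (Var y) \<phi> \<in> \<Delta>)"
| "decided \<Delta> (\<^bold>\<forall>\<^sup>2X. \<phi>) \<longleftrightarrow> (\<^bold>\<forall>\<^sup>2X. \<phi>) \<in> \<Delta> \<or> \<^bold>\<not> (\<^bold>\<forall>\<^sup>2X. \<phi>) \<in> \<Delta> \<and>
    (\<exists>Y. Y \<notin> allS \<phi> \<and> \<^bold>\<not> substS X Y \<phi> \<in> \<Delta>)"
| "decided \<Delta> \<phi> \<longleftrightarrow> \<phi> \<in> \<Delta> \<or> \<^bold>\<not> \<phi> \<in> \<Delta>"

lemma decidedI: "\<psi> \<in> \<Delta> \<Longrightarrow> decided \<Delta> \<psi>"
  by (cases \<psi>) simp_all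

lemma decided_mono: "decided \<Gamma> \<psi> \<Longrightarrow> \<Gamma> \<subseteq> \<Delta> \<Longrightarrow> decided \<Delta> \<psi>"
  by (cases \<psi>) auto

lemma decided_cases: "decided \<Delta> \<psi> \<Longrightarrow> \<psi> \<in> \<Delta> \<or> \<^bold>\<not> \<psi> \<in> \<Delta>"
  by (cases \<psi>) auto

lemma henkin_step:
  assumes "finite \<Gamma>" "consistent T \<Gamma>"
  shows "\<exists>\<Delta>. finite \<Delta> \<and> consistent T \<Delta> \<and> \<Gamma> \<subseteq> \<Delta> \<and> decided \<Delta> \<psi>"
proof (cases "consistent T (insert \<psi> \<Gamma>)")
  case True
  then show ?thesis using assms(1) by (intro exI[of _ "insert \<psi> \<Gamma>"]) (auto intro: decidedI)
next
  case False
  define \<Delta> where "\<Delta> = insert (\<^bold>\<not> \<psi>) \<Gamma>"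
  have con: "consistent T \<Delta>" unfolding \<Delta>_def
    using False assms(2) derives.MP[OF deduction derives_contradiction] by blast
  have \<Delta>: "finite \<Delta>" "\<Gamma> \<subseteq> \<Delta>" "\<^bold>\<not> \<psi> \<in> \<Delta>" using assms by (auto simp: \<Delta>_def)
  show ?thesis
  proof (cases \<psi>)
    case (AllN x \<phi>)
    obtain y where "y \<notin> allN \<phi>" "consistent T (insert (\<^bold>\<not> substN x (Var y) \<phi>) \<Delta>)"
      using consistent_witnessN[OF \<Delta>(1) con] \<Delta>(3) AllN by metis
    then show ?thesis using \<Delta>
      by (intro exI[of _ "insert (\<^bold>\<not> substN x (Var y) \<phi>) \<Delta>"] conjI) (auto simp: AllN)
  next
    case (AllS X \<phi>)
    obtain Y where "Y \<notin> allS \<phi>" "consistent T (insert (\<^bold>\<not> substS X Y \<phi>) \<Delta>)"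
      using consistent_witnessS[OF \<Delta>(1) con] \<Delta>(3) AllS by metis
    then show ?thesis using \<Delta>
      by (intro exI[of _ "insert (\<^bold>\<not> substS X Y \<phi>) \<Delta>"] conjI) (auto simp: AllS)
  qed (use con \<Delta> in \<open>intro exI[of _ \<Delta>], simp\<close>)+
qed

instance trm :: countable
  by countable_datatype

instance fm :: countable
  by countable_datatype

lemma derives_Union_chain:
  assumes "derives T (\<Union>n. G n) \<phi>" "\<And>n::nat. G n \<subseteq> G (Suc n)"
  shows "\<exists>n. derives T (G n) \<phi>"
  using assms(1)
proof (induction rule: derives.induct)
  case (Hyp \<phi>)
  then obtain n where "\<phi> \<in> G n" by blast
  then show ?case using derives.Hyp by blast
next
  case (Thm \<phi>)
  then show ?case using derives.Thm by blast
next
  case (MP \<phi> \<psi>)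
  from MP.IH obtain m n where "derives T (G m) (\<phi> \<^bold>\<longrightarrow> \<psi>)" "derives T (G n) \<phi>" by (elim exE)
  moreover have "G m \<subseteq> G (max m n)" "G n \<subseteq> G (max m n)"
    by (simp_all add: assms(2) lift_Suc_mono_le)
  ultimately show ?case
    by (intro exI[of _ "max m n"]) (rule derives.MP; erule (1) derives_mono)
qed

lemma henkin_extension:
  assumes "finite \<Gamma>" "consistent T \<Gamma>"
  shows "\<exists>\<Delta>. \<Gamma> \<subseteq> \<Delta> \<and> henkin_set T \<Delta>"
proof -
  have "\<exists>G. \<forall>n. (finite (G n) \<and> consistent T (G n) \<and> (n = 0 \<longrightarrow> G n = \<Gamma>)) \<and>
      (G n \<subseteq> G (Suc n) \<and> decided (G (Suc n)) (from_nat n))"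
  proof (rule dependent_nat_choice)
    show "\<exists>\<Delta>. finite \<Delta> \<and> consistent T \<Delta> \<and> ((0::nat) = 0 \<longrightarrow> \<Delta> = \<Gamma>)" using assms by blast
  next
    fix \<Delta> and n :: nat
    assume "finite \<Delta> \<and> consistent T \<Delta> \<and> (n = 0 \<longrightarrow> \<Delta> = \<Gamma>)"
    then have "\<exists>\<Delta>'. finite \<Delta>' \<and> consistent T \<Delta>' \<and> \<Delta> \<subseteq> \<Delta>' \<and> decided \<Delta>' (from_nat n)"
      by (intro henkin_step) auto
    then show "\<exists>\<Delta>'. (finite \<Delta>' \<and> consistent T \<Delta>' \<and> (Suc n = 0 \<longrightarrow> \<Delta>' = \<Gamma>)) \<and>
        \<Delta> \<subseteq> \<Delta>' \<and> decided \<Delta>' (from_nat n)" by simp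
  qed
  then obtain G where G: "\<And>n. consistent T (G n)" "G 0 = \<Gamma>" "\<And>n. G n \<subseteq> G (Suc n)"
    "\<And>n. decided (G (Suc n)) (from_nat n)" by blast
  let ?\<Delta> = "\<Union>n. G n"
  have con: "consistent T ?\<Delta>"
    using derives_Union_chain[of T G, OF _ G(3)] G(1) by blast
  have dec: "decided ?\<Delta> \<psi>" for \<psi>
    using decided_mono[OF G(4)[of "to_nat \<psi>"], of ?\<Delta>] by auto
  have neg: "\<psi> \<notin> ?\<Delta>" if "\<^bold>\<not> \<psi> \<in> ?\<Delta>" for \<psi>
    using con derives.MP[OF derives.Hyp[OF that] derives.Hyp] by blast
  have "henkin_set T ?\<Delta>"
  proof
    show "\<phi> \<in> ?\<Delta> \<or> \<^bold>\<not> \<phi> \<in> ?\<Delta>" for \<phi>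
      using dec by (rule decided_cases)
    show "\<exists>y. y \<notin> allN \<phi> \<and> substN x (Var y) \<phi> \<notin> ?\<Delta>" if "(\<^bold>\<forall>x. \<phi>) \<notin> ?\<Delta>" for x \<phi>
      using dec[of "\<^bold>\<forall>x. \<phi>"] that neg unfolding decided.simps by meson
    show "\<exists>Y. Y \<notin> allS \<phi> \<and> substS X Y \<phi> \<notin> ?\<Delta>" if "(\<^bold>\<forall>\<^sup>2X. \<phi>) \<notin> ?\<Delta>" for X \<phi>
      using dec[of "\<^bold>\<forall>\<^sup>2X. \<phi>"] that neg unfolding decided.simps by meson
  qed (rule con)
  then show ?thesis using G(2) by blast
qed

section \<open>Truth in two-sorted structures\<close>

locale two_sorted_structure =
  fixes zero :: 'a (\<open>\<zero>\<close>) and one :: 'a (\<open>\<one>\<close>)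
    and add :: "'a \<Rightarrow> 'a \<Rightarrow> 'a" (infixl \<open>\<oplus>\<close> 65)
    and mult :: "'a \<Rightarrow> 'a \<Rightarrow> 'a" (infixl \<open>\<otimes>\<close> 70)
    and less :: "'a \<Rightarrow> 'a \<Rightarrow> bool" (infix \<open>\<prec>\<close> 50)
    and Sets :: "'a set set"
begin

primrec val :: "(string \<Rightarrow> 'a) \<Rightarrow> trm \<Rightarrow> 'a" where
  "val e (Var x) = e x"
| "val e \<^bold>0 = \<zero>"
| "val e \<^bold>1 = \<one>"
| "val e (s \<^bold>+ t) = val e s \<oplus> val e t"
| "val e (s \<^bold>* t) = val e s \<otimes> val e t"

primrec sat :: "(string \<Rightarrow> 'a) \<Rightarrow> (string \<Rightarrow> 'a set) \<Rightarrow> fm \<Rightarrow> bool" where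
  "sat e E (s \<^bold>= t) \<longleftrightarrow> val e s = val e t"
| "sat e E (s \<^bold>< t) \<longleftrightarrow> val e s \<prec> val e t"
| "sat e E (t \<^bold>\<in> X) \<longleftrightarrow> val e t \<in> E X"
| "sat e E \<^bold>\<bottom> \<longleftrightarrow> False"
| "sat e E (\<phi> \<^bold>\<longrightarrow> \<psi>) \<longleftrightarrow> (sat e E \<phi> \<longrightarrow> sat e E \<psi>)"
| "sat e E (\<^bold>\<forall>x. \<phi>) \<longleftrightarrow> (\<forall>a. sat (e(x := a)) E \<phi>)"
| "sat e E (\<^bold>\<forall>\<^sup>2X. \<phi>) \<longleftrightarrow> (\<forall>A\<in>Sets. sat e (E(X := A)) \<phi>)"

lemma val_cong: "(\<And>x. x \<in> vars t \<Longrightarrow> e x = e' x) \<Longrightarrow> val e t = val e' t"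
  by (induction t) auto

lemma sat_cong:
  "(\<And>x. x \<in> freeN \<phi> \<Longrightarrow> e x = e' x) \<Longrightarrow> (\<And>X. X \<in> freeS \<phi> \<Longrightarrow> E X = E' X) \<Longrightarrow>
    sat e E \<phi> \<longleftrightarrow> sat e' E' \<phi>"
proof (induction \<phi> arbitrary: e e' E E')
  case (AllN x \<phi>)
  have "sat (e(x := a)) E \<phi> \<longleftrightarrow> sat (e'(x := a)) E' \<phi>" for a
    using AllN.prems by (intro AllN.IH) auto
  then show ?case by simp
next
  case (AllS X \<phi>)
  have "sat e (E(X := A)) \<phi> \<longleftrightarrow> sat e' (E'(X := A)) \<phi>" for A
    using AllS.prems by (intro AllS.IH) auto
  then show ?case by simp
next
  case (Imp \<phi> \<psi>)
  have "sat e E \<phi> \<longleftrightarrow> sat e' E' \<phi>" "sat e E \<psi> \<longleftrightarrow> sat e' E' \<psi>"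
    using Imp.prems by (intro Imp.IH; simp)+
  then show ?case by simp
next
  case (Eq s t)
  then show ?case using val_cong[of s e e'] val_cong[of t e e'] by simp
next
  case (Less s t)
  then show ?case using val_cong[of s e e'] val_cong[of t e e'] by simp
next
  case (Mem t X)
  then show ?case using val_cong[of t e e'] by simp
qed simp

lemma val_substT: "val e (substT x r t) = val (e(x := val e r)) t"
  by (induction t) auto

lemma sat_substN: "free_forN r x \<phi> \<Longrightarrow> sat e E (substN x r \<phi>) \<longleftrightarrow> sat (e(x := val e r)) E \<phi>"
proof (induction \<phi> arbitrary: e E)
  case (AllN y \<phi>)
  show ?case
  proof (cases "x \<in> freeN (\<^bold>\<forall>y. \<phi>)")
    case True
    then have "val (e(y := a)) r = val e r" for a
      using AllN.prems by (intro val_cong) auto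
    moreover have yx: "y \<noteq> x" and "free_forN r x \<phi>" using True AllN.prems by auto
    ultimately have "sat (e(y := a)) E (substN x r \<phi>) \<longleftrightarrow> sat (e(x := val e r, y := a)) E \<phi>" for a
      by (simp only: AllN.IH fun_upd_twist[OF yx])
    moreover have "substN x r (\<^bold>\<forall>y. \<phi>) = (\<^bold>\<forall>y. substN x r \<phi>)" using yx by simp
    ultimately show ?thesis by (simp only: sat.simps)
  next
    case False
    then have "sat e E (\<^bold>\<forall>y. \<phi>) \<longleftrightarrow> sat (e(x := val e r)) E (\<^bold>\<forall>y. \<phi>)"
      by (intro sat_cong) auto
    moreover have "substN x r (\<^bold>\<forall>y. \<phi>) = (\<^bold>\<forall>y. \<phi>)"
      using False by (rule substN_fresh)
    ultimately show ?thesis by (simp only:)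
  qed
qed (auto simp: val_substT)

lemma sat_substS: "free_forS Y X \<phi> \<Longrightarrow> sat e E (substS X Y \<phi>) \<longleftrightarrow> sat e (E(X := E Y)) \<phi>"
proof (induction \<phi> arbitrary: e E)
  case (AllS Z \<phi>)
  show ?case
  proof (cases "X \<in> freeS (\<^bold>\<forall>\<^sup>2Z. \<phi>)")
    case True
    then have ZX: "Z \<noteq> X" and ZY: "Z \<noteq> Y" and ff: "free_forS Y X \<phi>" using AllS.prems by auto
    have "(E(Z := A)) Y = E Y" for A using ZY by simp
    then have "sat e (E(Z := A)) (substS X Y \<phi>) \<longleftrightarrow> sat e (E(X := E Y, Z := A)) \<phi>" for A
      by (simp only: AllS.IH[OF ff] fun_upd_twist[OF ZX])
    moreover have "substS X Y (\<^bold>\<forall>\<^sup>2Z. \<phi>) = (\<^bold>\<forall>\<^sup>2Z. substS X Y \<phi>)" using ZX by simp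
    ultimately show ?thesis by (simp only: sat.simps)
  next
    case False
    then have "sat e E (\<^bold>\<forall>\<^sup>2Z. \<phi>) \<longleftrightarrow> sat e (E(X := E Y)) (\<^bold>\<forall>\<^sup>2Z. \<phi>)"
      by (intro sat_cong) auto
    moreover have "substS X Y (\<^bold>\<forall>\<^sup>2Z. \<phi>) = (\<^bold>\<forall>\<^sup>2Z. \<phi>)"
      using False by (rule substS_fresh)
    ultimately show ?thesis by (simp only:)
  qed
qed auto

text \<open>
  Axioms are open formulas, so a model has to satisfy them under every assignment, whereas the truth
  lemma concerns a single one; the universal closure mediates.
\<close>

lemma sat_AllNs:
  assumes "sat e E (foldr AllN xs \<phi>)" "\<And>x. x \<notin> set xs \<Longrightarrow> e' x = e x"
  shows "sat e' E \<phi>"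
  using assms
proof (induction xs arbitrary: e)
  case Nil
  then show ?case by (metis empty_iff list.set(1) ext foldr.simps(1) id_apply)
next
  case (Cons x xs)
  show ?case
  proof (rule Cons.IH)
    show "sat (e(x := e' x)) E (foldr AllN xs \<phi>)" using Cons.prems(1) by simp
  qed (use Cons.prems(2) in auto)
qed

lemma sat_AllSs:
  assumes "sat e E (foldr AllS Xs \<phi>)" "range E' \<subseteq> Sets" "\<And>X. X \<notin> set Xs \<Longrightarrow> E' X = E X"
  shows "sat e E' \<phi>"
  using assms
proof (induction Xs arbitrary: E)
  case Nil
  then show ?case by (metis empty_iff list.set(1) ext foldr.simps(1) id_apply)
next
  case (Cons X Xs)
  show ?case
  proof (rule Cons.IH)
    show "sat e (E(X := E' X)) (foldr AllS Xs \<phi>)" using Cons.prems(1,2) by auto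
  qed (use Cons.prems(2,3) in auto)
qed

end

lemma provable_AllNs: "T \<turnstile> \<phi> \<Longrightarrow> T \<turnstile> foldr AllN xs \<phi>"
  by (induction xs) (auto intro: GenN)

lemma provable_AllSs: "T \<turnstile> \<phi> \<Longrightarrow> T \<turnstile> foldr AllS Xs \<phi>"
  by (induction Xs) (auto intro: GenS)

lemma finite_freeN [simp]: "finite (freeN \<phi>)"
  by (induction \<phi>) auto

lemma finite_freeS [simp]: "finite (freeS \<phi>)"
  by (induction \<phi>) auto

primrec num :: "nat \<Rightarrow> trm" where
  "num 0 = \<^bold>0"
| "num (Suc n) = num n \<^bold>+ \<^bold>1"

lemma vars_num [simp]: "vars (num n) = {}"
  by (induction n) auto

context henkin_set
begin

lemma closed: "derives T \<Gamma> \<phi> \<Longrightarrow> \<phi> \<in> \<Gamma>"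
  using complete[of \<phi>] consistent derives.MP[OF derives.Hyp[of "\<^bold>\<not> \<phi>"]] by blast

lemma theorem_mem: "T \<turnstile> \<phi> \<Longrightarrow> \<phi> \<in> \<Gamma>"
  by (rule closed[OF derives.Thm])

lemma mp_mem: "\<phi> \<^bold>\<longrightarrow> \<psi> \<in> \<Gamma> \<Longrightarrow> \<phi> \<in> \<Gamma> \<Longrightarrow> \<psi> \<in> \<Gamma>"
  by (rule closed[OF derives.MP[OF derives.Hyp derives.Hyp]])

lemma Falsum_mem [simp]: "\<^bold>\<bottom> \<notin> \<Gamma>"
  using consistent derives.Hyp by blast

lemma Imp_mem [simp]: "\<phi> \<^bold>\<longrightarrow> \<psi> \<in> \<Gamma> \<longleftrightarrow> (\<phi> \<in> \<Gamma> \<longrightarrow> \<psi> \<in> \<Gamma>)"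
proof -
  have "\<phi> \<^bold>\<longrightarrow> \<psi> \<in> \<Gamma>" if "\<psi> \<in> \<Gamma>" for \<psi>
    using mp_mem[OF theorem_mem[OF Imp_K] that] .
  moreover have "\<phi> \<^bold>\<longrightarrow> \<psi> \<in> \<Gamma>" if "\<^bold>\<not> \<phi> \<in> \<Gamma>"
  proof (rule closed[OF deduction[OF derives_contradiction]])
    show "derives T (insert (\<^bold>\<not> \<psi>) (insert \<phi> \<Gamma>)) \<^bold>\<bottom>"
      by (rule derives.MP[of _ _ \<phi>]; rule derives.Hyp) (simp_all add: that)
  qed
  ultimately show ?thesis using mp_mem complete[of \<phi>] by blast
qed

lemma AllN_inst: "(\<^bold>\<forall>x. \<phi>) \<in> \<Gamma> \<Longrightarrow> free_forN t x \<phi> \<Longrightarrow> substN x t \<phi> \<in> \<Gamma>"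
  by (rule mp_mem[OF theorem_mem[OF InstN]])

lemma AllS_inst: "(\<^bold>\<forall>\<^sup>2X. \<phi>) \<in> \<Gamma> \<Longrightarrow> free_forS Y X \<phi> \<Longrightarrow> substS X Y \<phi> \<in> \<Gamma>"
  by (rule mp_mem[OF theorem_mem[OF InstS]])

lemma refl_mem [simp]: "t \<^bold>= t \<in> \<Gamma>"
  by (rule theorem_mem[OF Eq_Refl])

lemma replace:
  "s \<^bold>= t \<in> \<Gamma> \<Longrightarrow> substN x s \<phi> \<in> \<Gamma> \<Longrightarrow> free_forN s x \<phi> \<Longrightarrow> free_forN t x \<phi> \<Longrightarrow> substN x t \<phi> \<in> \<Gamma>"
  using theorem_mem[OF Eq_Subst, of s x \<phi> t] by simp

lemma sym_mem: "s \<^bold>= t \<in> \<Gamma> \<Longrightarrow> t \<^bold>= s \<in> \<Gamma>"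
proof -
  assume st: "s \<^bold>= t \<in> \<Gamma>"
  obtain x where "x \<notin> vars s" using fresh_string[OF finite_vars] by blast
  then show ?thesis using replace[OF st, of x "Var x \<^bold>= s"] by simp
qed

lemma trans_mem: "s \<^bold>= t \<in> \<Gamma> \<Longrightarrow> t \<^bold>= u \<in> \<Gamma> \<Longrightarrow> s \<^bold>= u \<in> \<Gamma>"
proof -
  assume st: "s \<^bold>= t \<in> \<Gamma>" and tu: "t \<^bold>= u \<in> \<Gamma>"
  obtain x where "x \<notin> vars s" using fresh_string[OF finite_vars] by blast
  then show ?thesis using st replace[OF tu, of x "s \<^bold>= Var x"] by simp
qed

lemma cong_mem:
  assumes st: "s \<^bold>= t \<in> \<Gamma>"
  shows "s \<^bold>+ u \<^bold>= t \<^bold>+ u \<in> \<Gamma>" "u \<^bold>+ s \<^bold>= u \<^bold>+ t \<in> \<Gamma>"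
    "s \<^bold>* u \<^bold>= t \<^bold>* u \<in> \<Gamma>" "u \<^bold>* s \<^bold>= u \<^bold>* t \<in> \<Gamma>"
    "s \<^bold>< u \<in> \<Gamma> \<Longrightarrow> t \<^bold>< u \<in> \<Gamma>" "u \<^bold>< s \<in> \<Gamma> \<Longrightarrow> u \<^bold>< t \<in> \<Gamma>"
    "s \<^bold>\<in> X \<in> \<Gamma> \<Longrightarrow> t \<^bold>\<in> X \<in> \<Gamma>"
proof -
  obtain x where x: "x \<notin> vars s \<union> vars u" using fresh_string[of "vars s \<union> vars u"] by auto
  note r = replace[OF st, of x]
  show "s \<^bold>+ u \<^bold>= t \<^bold>+ u \<in> \<Gamma>" using x r[of "s \<^bold>+ u \<^bold>= Var x \<^bold>+ u"] by simp
  show "u \<^bold>+ s \<^bold>= u \<^bold>+ t \<in> \<Gamma>" using x r[of "u \<^bold>+ s \<^bold>= u \<^bold>+ Var x"] by simp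
  show "s \<^bold>* u \<^bold>= t \<^bold>* u \<in> \<Gamma>" using x r[of "s \<^bold>* u \<^bold>= Var x \<^bold>* u"] by simp
  show "u \<^bold>* s \<^bold>= u \<^bold>* t \<in> \<Gamma>" using x r[of "u \<^bold>* s \<^bold>= u \<^bold>* Var x"] by simp
  show "s \<^bold>< u \<in> \<Gamma> \<Longrightarrow> t \<^bold>< u \<in> \<Gamma>" using x r[of "Var x \<^bold>< u"] by simp
  show "u \<^bold>< s \<in> \<Gamma> \<Longrightarrow> u \<^bold>< t \<in> \<Gamma>" using x r[of "u \<^bold>< Var x"] by simp
  show "s \<^bold>\<in> X \<in> \<Gamma> \<Longrightarrow> t \<^bold>\<in> X \<in> \<Gamma>" using r[of "Var x \<^bold>\<in> X"] by simp
qed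

text \<open>
  The witness for \<open>\<exists>x. x = t\<close> avoids the variables of the formula, but there is no reason why it should
  avoid \<open>F\<close>. So apply the witness property to \<open>\<exists>x. x = t \<and> \<tau>\<close>, where \<open>\<tau>\<close> is a tautology in which
  all variables of \<open>F\<close> occur.
\<close>

lemma alias_number:
  assumes "finite F"
  obtains y where "y \<notin> F" "Var y \<^bold>= t \<in> \<Gamma>"
proof -
  obtain zs where zs: "set zs = F" using finite_list[OF assms] by blast
  obtain x where x: "x \<notin> vars t \<union> F" using fresh_string[of "vars t \<union> F"] assms by auto
  \<comment> \<open>the negation of the tautology\<close>
  define mention where "mention = foldr (\<lambda>z \<chi>. (Var z \<^bold>= Var z) \<^bold>\<longrightarrow> \<chi>) zs \<^bold>\<bottom>"
  have m: "allN mention = F" "mention \<notin> \<Gamma>"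
    unfolding mention_def zs[symmetric] by (induction zs) auto
  have fresh: "substN x r mention = mention" for r
    using m(1) x not_freeN[of x mention] by simp
  have ff: "free_forN r x mention" for r
    unfolding mention_def by (induction zs) auto
  have "(\<^bold>\<forall>x. Var x \<^bold>= t \<^bold>\<longrightarrow> mention) \<notin> \<Gamma>"
  proof
    assume "(\<^bold>\<forall>x. Var x \<^bold>= t \<^bold>\<longrightarrow> mention) \<in> \<Gamma>"
    from AllN_inst[OF this, of t] x m(2) show False by (simp add: fresh ff)
  qed
  from witnessN[OF this] m x show thesis by (auto simp: fresh intro: that)
qed

text \<open>
  There is no equation between sets in the language, so the alias of \<open>X\<close> is obtained as a witness for
  the existence of a set with the same elements.
\<close>

lemma alias_set:
  assumes "finite F"
  obtains Y where "Y \<notin> F" "\<And>t. t \<^bold>\<in> Y \<in> \<Gamma> \<longleftrightarrow> t \<^bold>\<in> X \<in> \<Gamma>"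
proof -
  obtain Zs where Zs: "set Zs = F" using finite_list[OF assms] by blast
  obtain V where V: "V \<notin> insert X F" using fresh_string[of "insert X F"] assms by auto
  define mention where "mention = foldr (\<lambda>Z \<chi>. (\<^bold>0 \<^bold>\<in> Z \<^bold>\<longrightarrow> \<^bold>0 \<^bold>\<in> Z) \<^bold>\<longrightarrow> \<chi>) Zs \<^bold>\<bottom>"
  have m: "allS mention = F" "mention \<notin> \<Gamma>"
    unfolding mention_def Zs[symmetric] by (induction Zs) auto
  have fresh: "substS V Y mention = mention" for Y
    using m(1) V not_freeS[of V mention] by simp
  have ff: "free_forS Y V mention" for Y
    unfolding mention_def by (induction Zs) auto
  let ?u = "''u''"
  let ?sub = "\<lambda>Y X. \<^bold>\<forall>?u. Var ?u \<^bold>\<in> Y \<^bold>\<longrightarrow> Var ?u \<^bold>\<in> X"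
  have refl: "?sub X X \<in> \<Gamma>"
    by (intro theorem_mem GenN Imp_refl)
  have "(\<^bold>\<forall>\<^sup>2V. ?sub V X \<^bold>\<longrightarrow> ?sub X V \<^bold>\<longrightarrow> mention) \<notin> \<Gamma>"
  proof
    assume "(\<^bold>\<forall>\<^sup>2V. ?sub V X \<^bold>\<longrightarrow> ?sub X V \<^bold>\<longrightarrow> mention) \<in> \<Gamma>"
    from AllS_inst[OF this, of X] V m(2) refl show False by (simp add: fresh ff)
  qed
  from witnessS[OF this] m V obtain Y where "Y \<notin> F" "?sub Y X \<in> \<Gamma>" "?sub X Y \<in> \<Gamma>"
    by (auto simp: fresh)
  moreover from this AllN_inst[of ?u "Var ?u \<^bold>\<in> Y \<^bold>\<longrightarrow> Var ?u \<^bold>\<in> X"] AllN_inst[of ?u "Var ?u \<^bold>\<in> X \<^bold>\<longrightarrow> Var ?u \<^bold>\<in> Y"]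
  have "t \<^bold>\<in> Y \<in> \<Gamma> \<longleftrightarrow> t \<^bold>\<in> X \<in> \<Gamma>" for t by auto
  ultimately show thesis using that[of Y] by blast
qed

end

section \<open>The canonical model\<close>

locale arithmetic_henkin_set = henkin_set +
  assumes arithmetic: "ordered_semiring_axioms \<subseteq> T"
begin

lemma num_less: "m < n \<Longrightarrow> num m \<^bold>< num n \<in> \<Gamma>"
proof (induction n)
  case (Suc n)
  have ax: "\<phi> \<in> ordered_semiring_axioms \<Longrightarrow> T \<turnstile> \<phi>" for \<phi>
    using arithmetic Axiom by blast
  let ?x = "''x''" and ?y = "''y''" and ?z = "''z''"
  have add_comm: "T \<turnstile> Var ?x \<^bold>+ Var ?y \<^bold>= Var ?y \<^bold>+ Var ?x"
    by (rule ax) (simp add: ordered_semiring_axioms_def Let_def)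
  have add_0: "T \<turnstile> Var ?x \<^bold>+ \<^bold>0 \<^bold>= Var ?x"
    by (rule ax) (simp add: ordered_semiring_axioms_def Let_def)
  have less_trans: "T \<turnstile> Var ?x \<^bold>< Var ?y \<^bold>\<and> Var ?y \<^bold>< Var ?z \<^bold>\<longrightarrow> Var ?x \<^bold>< Var ?z"
    by (rule ax) (simp add: ordered_semiring_axioms_def Let_def)
  have add_less: "T \<turnstile> Var ?x \<^bold>< Var ?y \<^bold>\<longrightarrow> Var ?x \<^bold>+ Var ?z \<^bold>< Var ?y \<^bold>+ Var ?z"
    by (rule ax) (simp add: ordered_semiring_axioms_def Let_def)
  have "T \<turnstile> \<^bold>0 \<^bold>< \<^bold>1"
    by (rule ax) (simp add: ordered_semiring_axioms_def Let_def)
  then have "\<^bold>0 \<^bold>+ num n \<^bold>< \<^bold>1 \<^bold>+ num n \<in> \<Gamma>"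
    using theorem_mem[OF provable_instN[OF provable_instN[OF provable_instN[OF add_less, of "\<^bold>0" ?x], of "\<^bold>1" ?y],
        of "num n" ?z]] theorem_mem by simp
  moreover have "\<^bold>1 \<^bold>+ num n \<^bold>= num n \<^bold>+ \<^bold>1 \<in> \<Gamma>"
    using theorem_mem[OF provable_instN[OF provable_instN[OF add_comm, of "\<^bold>1" ?x], of "num n" ?y]] by simp
  moreover have "\<^bold>0 \<^bold>+ num n \<^bold>= num n \<^bold>+ \<^bold>0 \<in> \<Gamma>"
    using theorem_mem[OF provable_instN[OF provable_instN[OF add_comm, of "\<^bold>0" ?x], of "num n" ?y]] by simp
  moreover have "num n \<^bold>+ \<^bold>0 \<^bold>= num n \<in> \<Gamma>"
    using theorem_mem[OF provable_instN[OF add_0, of "num n" ?x]] by simp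
  ultimately have *: "num n \<^bold>< num (Suc n) \<in> \<Gamma>"
    using cong_mem(5,6) by (metis num.simps(2))
  show ?case
  proof (cases "m = n")
    case False
    with Suc have "num m \<^bold>< num n \<in> \<Gamma>" by simp
    with * theorem_mem[OF provable_instN[OF provable_instN[OF provable_instN[OF less_trans, of "num m" ?x], of "num n" ?y],
        of "num (Suc n)" ?z]]
    show ?thesis by simp
  qed (use * in simp)
qed simp

definition cls :: "trm \<Rightarrow> trm set" where
  "cls t = {s. s \<^bold>= t \<in> \<Gamma>}"

lemma cls_eq [simp]: "cls s = cls t \<longleftrightarrow> s \<^bold>= t \<in> \<Gamma>"
  unfolding cls_def using sym_mem trans_mem refl_mem by blast

text \<open>
  The numbers of the canonical model are the classes of provably equal terms. There being countably
  infinitely many of them, they can be identified with the natural numbers, and every structure to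
  be considered then lives on a type instead of a carrier set.
\<close>

lemma infinite_classes: "infinite (range cls)"
proof -
  have "num m \<^bold>= num n \<notin> \<Gamma>" if "m < n" for m n
  proof
    assume eq: "num m \<^bold>= num n \<in> \<Gamma>"
    have "num m \<^bold>< num m \<in> \<Gamma>"
      using cong_mem(6)[OF sym_mem[OF eq] num_less[OF that]] .
    moreover have "T \<turnstile> \<^bold>\<not> Var ''x'' \<^bold>< Var ''x''"
      using arithmetic by (intro Axiom) (auto simp: ordered_semiring_axioms_def Let_def)
    from theorem_mem[OF provable_instN[OF this, of "num m" "''x''"]]
    have "num m \<^bold>< num m \<notin> \<Gamma>" by simp
    ultimately show False by simp
  qed
  then have "inj (\<lambda>n. cls (num n))"
    unfolding inj_def by (metis cls_eq linorder_neqE_nat sym_mem)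
  then have "infinite (range (\<lambda>n. cls (num n)))" by (rule range_inj_infinite)
  then show ?thesis by (rule infinite_super[rotated]) auto
qed

definition name :: "trm \<Rightarrow> nat" where
  "name t = to_nat_on (range cls) (cls t)"

definition rep :: "nat \<Rightarrow> trm" where
  "rep n = (SOME t. name t = n)"

lemma name_eq: "name s = name t \<longleftrightarrow> s \<^bold>= t \<in> \<Gamma>"
  unfolding name_def by (subst to_nat_on_inj) auto

lemma name_rep [simp]: "name (rep n) = n"
proof -
  have "n \<in> to_nat_on (range cls) ` range cls"
    using bij_betw_imp_surj_on[OF to_nat_on_infinite[OF _ infinite_classes]] by auto
  then have "\<exists>t. name t = n" by (auto simp: name_def)
  then show ?thesis unfolding rep_def by (rule someI_ex)
qed

lemma rep_name: "rep (name t) \<^bold>= t \<in> \<Gamma>"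
  by (simp flip: name_eq)

definition extension :: "string \<Rightarrow> nat set" where
  "extension X = {name t | t. t \<^bold>\<in> X \<in> \<Gamma>}"

interpretation canonical: two_sorted_structure "name \<^bold>0" "name \<^bold>1" "\<lambda>a b. name (rep a \<^bold>+ rep b)"
  "\<lambda>a b. name (rep a \<^bold>* rep b)" "\<lambda>a b. rep a \<^bold>< rep b \<in> \<Gamma>" "range extension" .

abbreviation "e0 \<equiv> \<lambda>x. name (Var x)"

lemma val_canonical: "canonical.val e0 t = name t"
proof (induction t)
  case (Plus s t)
  have "rep (name s) \<^bold>+ rep (name t) \<^bold>= s \<^bold>+ t \<in> \<Gamma>"
    using cong_mem(1,2) rep_name trans_mem by blast
  with Plus show ?case by (simp add: name_eq)
next
  case (Times s t)
  have "rep (name s) \<^bold>* rep (name t) \<^bold>= s \<^bold>* t \<in> \<Gamma>"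
    using cong_mem(3,4) rep_name trans_mem by blast
  with Times show ?case by (simp add: name_eq)
qed auto

lemma rep_less: "rep (name s) \<^bold>< rep (name t) \<in> \<Gamma> \<longleftrightarrow> s \<^bold>< t \<in> \<Gamma>"
  using cong_mem(5,6) rep_name sym_mem by blast

lemma name_extension: "name t \<in> extension X \<longleftrightarrow> t \<^bold>\<in> X \<in> \<Gamma>"
  unfolding extension_def by (auto simp: name_eq intro: cong_mem(7)[OF sym_mem] refl_mem)

text \<open>
  A quantifier over numbers ranges over the names of terms. Each of them is the name of a variable
  that does not occur in the matrix, so the induction only ever substitutes such variables, which is
  always capture-free; hence the induction is on the size of the formula.
\<close>

lemma truth: "canonical.sat e0 extension \<phi> \<longleftrightarrow> \<phi> \<in> \<Gamma>"
proof (induction "size \<phi>" arbitrary: \<phi> rule: less_induct)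
  case less
  show ?case
  proof (cases \<phi>)
    case (AllN x \<psi>)
    have IH: "canonical.sat (e0(x := name (Var y))) extension \<psi> \<longleftrightarrow> substN x (Var y) \<psi> \<in> \<Gamma>"
      if "y \<notin> allN \<psi>" for y
      using less.hyps[of "substN x (Var y) \<psi>"] canonical.sat_substN[OF free_forN_fresh[OF that], of e0]
      by (simp add: AllN)
    show ?thesis
    proof
      assume "canonical.sat e0 extension \<phi>"
      then show "\<phi> \<in> \<Gamma>" using witnessN[of x \<psi>] IH AllN by auto
    next
      assume \<phi>: "\<phi> \<in> \<Gamma>"
      have "canonical.sat (e0(x := a)) extension \<psi>" for a
      proof -
        obtain y where y: "y \<notin> allN \<psi>" "Var y \<^bold>= rep a \<in> \<Gamma>" by (rule alias_number[OF finite_allN])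
        then have "name (Var y) = a" by (simp flip: name_eq)
        moreover have "substN x (Var y) \<psi> \<in> \<Gamma>"
          using \<phi> AllN AllN_inst free_forN_fresh y(1) by blast
        ultimately show ?thesis using IH[OF y(1)] by simp
      qed
      then show "canonical.sat e0 extension \<phi>" by (simp add: AllN)
    qed
  next
    case (AllS X \<psi>)
    have IH: "canonical.sat e0 (extension(X := extension Y)) \<psi> \<longleftrightarrow> substS X Y \<psi> \<in> \<Gamma>"
      if "Y \<notin> allS \<psi>" for Y
      using less.hyps[of "substS X Y \<psi>"] canonical.sat_substS[OF free_forS_fresh[OF that], of e0]
      by (simp add: AllS)
    show ?thesis
    proof
      assume "canonical.sat e0 extension \<phi>"
      then show "\<phi> \<in> \<Gamma>" using witnessS[of X \<psi>] IH AllS by auto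
    next
      assume \<phi>: "\<phi> \<in> \<Gamma>"
      have "canonical.sat e0 (extension(X := extension Z)) \<psi>" for Z
      proof -
        obtain Y where Y: "Y \<notin> allS \<psi>" "\<And>t. t \<^bold>\<in> Y \<in> \<Gamma> \<longleftrightarrow> t \<^bold>\<in> Z \<in> \<Gamma>"
          by (rule alias_set[OF finite_allS, of \<psi> Z]) blast
        then have "extension Y = extension Z" by (simp add: extension_def)
        moreover have "substS X Y \<psi> \<in> \<Gamma>"
          using \<phi> AllS AllS_inst free_forS_fresh Y(1) by blast
        ultimately show ?thesis using IH[OF Y(1)] by simp
      qed
      then show "canonical.sat e0 extension \<phi>" by (simp add: AllS)
    qed
  next
    case (Imp \<psi> \<chi>)
    with less.hyps[of \<psi>] less.hyps[of \<chi>] show ?thesis by simp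
  qed (auto simp: val_canonical name_eq rep_less name_extension)
qed

lemma canonical_model:
  assumes "T \<turnstile> \<phi>" "range E \<subseteq> range extension"
  shows "canonical.sat e E \<phi>"
proof -
  obtain xs where xs: "set xs = freeN \<phi>" using finite_list[OF finite_freeN] by blast
  obtain Xs where Xs: "set Xs = freeS \<phi>" using finite_list[OF finite_freeS] by blast
  define e' where "e' = (\<lambda>x. if x \<in> freeN \<phi> then e x else e0 x)"
  define E' where "E' = (\<lambda>X. if X \<in> freeS \<phi> then E X else extension X)"
  have "canonical.sat e0 extension (foldr AllN xs (foldr AllS Xs \<phi>))"
    by (simp add: truth theorem_mem provable_AllNs provable_AllSs assms(1))
  then have "canonical.sat e' extension (foldr AllS Xs \<phi>)"
    by (rule canonical.sat_AllNs) (simp add: e'_def xs)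
  then have "canonical.sat e' E' \<phi>"
    by (rule canonical.sat_AllSs) (use assms(2) in \<open>auto simp: E'_def Xs\<close>)
  then show ?thesis
    by (subst canonical.sat_cong[of _ _ e' _ E']) (simp_all add: e'_def E'_def)
qed

end

text \<open>
  If \<open>\<phi>\<close> were not provable, a Henkin set containing \<open>\<^bold>\<not> \<phi>\<close> would define a model of \<open>T\<close> in
  which \<open>\<phi>\<close> fails. The arithmetical axioms in \<open>T\<close> make its domain infinite.
\<close>

theorem completeness:
  assumes arithmetic: "ordered_semiring_axioms \<subseteq> T"
    and valid: "\<And>zero one add mult less Sets e E. (Sets :: nat set set) \<noteq> {} \<Longrightarrow>
      (\<And>\<psi> e E. \<psi> \<in> T \<Longrightarrow> range E \<subseteq> Sets \<Longrightarrow> two_sorted_structure.sat zero one add mult less Sets e E \<psi>) \<Longrightarrow>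
      range E \<subseteq> Sets \<Longrightarrow> two_sorted_structure.sat zero one add mult less Sets e E \<phi>"
  shows "T \<turnstile> \<phi>"
proof (rule ccontr)
  assume "\<not> T \<turnstile> \<phi>"
  then have "consistent T {\<^bold>\<not> \<phi>}"
    using derives_contradiction derives_empty by blast
  then obtain \<Gamma> where "{\<^bold>\<not> \<phi>} \<subseteq> \<Gamma>" "henkin_set T \<Gamma>"
    using henkin_extension[of "{\<^bold>\<not> \<phi>}" T] by auto
  then interpret arithmetic_henkin_set T \<Gamma>
    by (simp add: arithmetic_henkin_set_def arithmetic_henkin_set_axioms_def arithmetic)
  have "two_sorted_structure.sat (name \<^bold>0) (name \<^bold>1) (\<lambda>a b. name (rep a \<^bold>+ rep b))
     (\<lambda>a b. name (rep a \<^bold>* rep b)) (\<lambda>a b. rep a \<^bold>< rep b \<in> \<Gamma>) (range extension) (\<lambda>x. name (Var x)) extension \<phi>"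
    by (rule valid) (auto intro: canonical_model Axiom)
  then have "\<phi> \<in> \<Gamma>" by (simp add: truth)
  with \<open>{\<^bold>\<not> \<phi>} \<subseteq> \<Gamma>\<close> show False by (auto dest: mp_mem)
qed

section \<open>Arithmetic and comprehension in models of RCA0\<close>

text \<open>
  Defining the bounded existential quantifier as \<open>\<not>\<forall>\<not>\<close> makes \<open>Delta00\<close> provable by the rules for
  implication and the bounded universal quantifier alone, which never compete with each other; this is
  why \<open>Delta00_intros\<close> leaves out the last rule.
\<close>

abbreviation AllB :: "string \<Rightarrow> trm \<Rightarrow> fm \<Rightarrow> fm" where
  "AllB x t \<phi> \<equiv> \<^bold>\<forall>x. Var x \<^bold>< t \<^bold>\<longrightarrow> \<phi>"

abbreviation ExB :: "string \<Rightarrow> trm \<Rightarrow> fm \<Rightarrow> fm" where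
  "ExB x t \<phi> \<equiv> \<^bold>\<not> AllB x t (\<^bold>\<not> \<phi>)"

lemmas Delta00_intros = Delta00.intros(1-6)

locale rca0_model = two_sorted_structure +
  assumes Sets_nonempty: "Sets \<noteq> {}"
    and RCA0: "\<phi> \<in> RCA0 \<Longrightarrow> range E \<subseteq> Sets \<Longrightarrow> sat e E \<phi>"
begin

definition le :: "'a \<Rightarrow> 'a \<Rightarrow> bool" (infix \<open>\<preceq>\<close> 50) where
  "a \<preceq> b \<longleftrightarrow> a \<prec> b \<or> a = b"

lemma semiring_laws:
  shows "(a \<oplus> b) \<oplus> c = a \<oplus> (b \<oplus> c)" "a \<oplus> b = b \<oplus> a"
    "(a \<otimes> b) \<otimes> c = a \<otimes> (b \<otimes> c)" "a \<otimes> b = b \<otimes> a"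
    "a \<otimes> (b \<oplus> c) = a \<otimes> b \<oplus> a \<otimes> c" "a \<oplus> \<zero> = a" "a \<otimes> \<zero> = \<zero>" "a \<otimes> \<one> = a"
    "a \<prec> b \<Longrightarrow> b \<prec> c \<Longrightarrow> a \<prec> c" "\<not> a \<prec> a" "a \<prec> b \<or> a = b \<or> b \<prec> a"
    "a \<prec> b \<Longrightarrow> a \<oplus> c \<prec> b \<oplus> c" "\<zero> \<prec> c \<Longrightarrow> a \<prec> b \<Longrightarrow> a \<otimes> c \<prec> b \<otimes> c"
    "a \<prec> b \<Longrightarrow> \<exists>c. a \<oplus> c = b" "\<zero> \<prec> \<one>" "\<zero> \<prec> a \<Longrightarrow> \<one> \<preceq> a" "\<zero> \<preceq> a"
proof -
  obtain A where "A \<in> Sets" using Sets_nonempty by blast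
  then have "sat ((\<lambda>_. c)(''x'' := a, ''y'' := b)) (\<lambda>_. A) \<phi>" if "\<phi> \<in> ordered_semiring_axioms" for \<phi>
    using that by (intro RCA0) (auto simp: RCA0_def)
  then have "\<forall>\<phi>\<in>ordered_semiring_axioms. sat ((\<lambda>_. c)(''x'' := a, ''y'' := b)) (\<lambda>_. A) \<phi>" by blast
  then have *: "(a \<oplus> b) \<oplus> c = a \<oplus> (b \<oplus> c) \<and> a \<oplus> b = b \<oplus> a \<and>
    (a \<otimes> b) \<otimes> c = a \<otimes> (b \<otimes> c) \<and> a \<otimes> b = b \<otimes> a \<and>
    a \<otimes> (b \<oplus> c) = a \<otimes> b \<oplus> a \<otimes> c \<and> a \<oplus> \<zero> = a \<and> a \<otimes> \<zero> = \<zero> \<and> a \<otimes> \<one> = a \<and>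
    (a \<prec> b \<longrightarrow> b \<prec> c \<longrightarrow> a \<prec> c) \<and> \<not> a \<prec> a \<and> (a \<prec> b \<or> a = b \<or> b \<prec> a) \<and>
    (a \<prec> b \<longrightarrow> a \<oplus> c \<prec> b \<oplus> c) \<and> (\<zero> \<prec> c \<longrightarrow> a \<prec> b \<longrightarrow> a \<otimes> c \<prec> b \<otimes> c) \<and>
    (a \<prec> b \<longrightarrow> (\<exists>c. a \<oplus> c = b)) \<and> \<zero> \<prec> \<one> \<and> (\<zero> \<prec> a \<longrightarrow> \<one> \<preceq> a) \<and> \<zero> \<preceq> a"
    unfolding ordered_semiring_axioms_def Let_def le_def by (simp (no_asm_use)) blast
  from * show "(a \<oplus> b) \<oplus> c = a \<oplus> (b \<oplus> c)" by blast
  from * show "a \<oplus> b = b \<oplus> a" by blast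
  from * show "(a \<otimes> b) \<otimes> c = a \<otimes> (b \<otimes> c)" by blast
  from * show "a \<otimes> b = b \<otimes> a" by blast
  from * show "a \<otimes> (b \<oplus> c) = a \<otimes> b \<oplus> a \<otimes> c" by blast
  from * show "a \<oplus> \<zero> = a" by blast
  from * show "a \<otimes> \<zero> = \<zero>" by blast
  from * show "a \<otimes> \<one> = a" by blast
  from * show "a \<prec> b \<Longrightarrow> b \<prec> c \<Longrightarrow> a \<prec> c" by blast
  from * show "\<not> a \<prec> a" by blast
  from * show "a \<prec> b \<or> a = b \<or> b \<prec> a" by blast
  from * show "a \<prec> b \<Longrightarrow> a \<oplus> c \<prec> b \<oplus> c" by blast
  from * show "\<zero> \<prec> c \<Longrightarrow> a \<prec> b \<Longrightarrow> a \<otimes> c \<prec> b \<otimes> c" by blast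
  from * show "a \<prec> b \<Longrightarrow> \<exists>c. a \<oplus> c = b" by blast
  from * show "\<zero> \<prec> \<one>" by blast
  from * show "\<zero> \<prec> a \<Longrightarrow> \<one> \<preceq> a" by blast
  from * show "\<zero> \<preceq> a" by blast
qed

sublocale linorder le less
  by unfold_locales (use semiring_laws(9-11) in \<open>unfold le_def, blast+\<close>)

sublocale comm_semiring_1 mult one add zero
proof
  show "\<zero> \<noteq> \<one>" using semiring_laws(15) by auto
  show "(a \<oplus> b) \<otimes> c = a \<otimes> c \<oplus> b \<otimes> c" for a b c
    using semiring_laws(4,5) by metis
qed (use semiring_laws(1-8) in \<open>metis+\<close>)

lemma zero_le [simp]: "\<zero> \<preceq> a"
  by (rule semiring_laws(17))

lemma add_le_cancel [simp]: "a \<oplus> c \<preceq> b \<oplus> c \<longleftrightarrow> a \<preceq> b"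
  using semiring_laws(12) by (metis le_less not_le)

lemma add_left_cancel_iff [simp]: "a \<oplus> c = b \<oplus> c \<longleftrightarrow> a = b"
  using add_le_cancel order.eq_iff by blast

lemma add_left_cancel_iff' [simp]: "c \<oplus> a = c \<oplus> b \<longleftrightarrow> a = b"
  using add_left_cancel_iff[of a c b] by (simp add: add.commute)

lemma add_mono: "a \<preceq> b \<Longrightarrow> c \<preceq> d \<Longrightarrow> a \<oplus> c \<preceq> b \<oplus> d"
  by (metis add_le_cancel add.commute order.trans)

lemma le_add: "a \<preceq> a \<oplus> b" "a \<preceq> b \<oplus> a"
  using add_mono[of a a \<zero> b] add_mono[of \<zero> b a a] by (simp_all add: add.commute)

lemma mult_mono1: "a \<preceq> b \<Longrightarrow> a \<otimes> c \<preceq> b \<otimes> c"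
proof (cases "c = \<zero>")
  case False
  then show "a \<preceq> b \<Longrightarrow> a \<otimes> c \<preceq> b \<otimes> c"
    using semiring_laws(13)[of c a b] zero_le[of c] by (auto simp: le_less)
qed simp

lemma mult_mono: "a \<preceq> b \<Longrightarrow> c \<preceq> d \<Longrightarrow> a \<otimes> c \<preceq> b \<otimes> d"
  using mult_mono1[of a b c] mult_mono1[of c d b] by (simp add: mult.commute)

lemma less_add_one [simp]: "a \<prec> b \<oplus> \<one> \<longleftrightarrow> a \<preceq> b"
proof
  assume "a \<prec> b \<oplus> \<one>"
  show "a \<preceq> b"
  proof (rule ccontr)
    assume "\<not> a \<preceq> b"
    then have "b \<prec> a" by simp
    then obtain c where c: "b \<oplus> c = a" using semiring_laws(14) by blast
    have "\<zero> \<prec> c" using \<open>b \<prec> a\<close> c zero_le[of c] add_0_right[of b] by (metis le_less less_irrefl)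
    then have "\<one> \<preceq> c" by (rule semiring_laws(16))
    then have "b \<oplus> \<one> \<preceq> a" using add_mono[of b b \<one> c] c by simp
    with \<open>a \<prec> b \<oplus> \<one>\<close> show False by simp
  qed
next
  assume "a \<preceq> b"
  moreover have "b \<prec> b \<oplus> \<one>"
    using semiring_laws(12)[OF semiring_laws(15), of b] by (simp add: add.commute)
  ultimately show "a \<prec> b \<oplus> \<one>" by simp
qed

lemma not_less_zero [simp]: "\<not> a \<prec> \<zero>"
  using zero_le[of a] by (simp add: not_less)

lemma sat_And: "sat e E (\<phi> \<^bold>\<and> \<psi>) \<longleftrightarrow> sat e E \<phi> \<and> sat e E \<psi>"
  and sat_Or: "sat e E (\<phi> \<^bold>\<or> \<psi>) \<longleftrightarrow> sat e E \<phi> \<or> sat e E \<psi>"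
  and sat_ExB: "sat e E (ExB x t \<phi>) \<longleftrightarrow> (\<exists>a. a \<prec> val (e(x := a)) t \<and> sat (e(x := a)) E \<phi>)"
  and sat_ExN: "sat e E (\<^bold>\<exists>x. \<phi>) \<longleftrightarrow> (\<exists>a. sat (e(x := a)) E \<phi>)"
  by auto

definition pr :: "'a \<Rightarrow> 'a \<Rightarrow> 'a" where
  "pr a b = (a \<oplus> b) \<otimes> (a \<oplus> b) \<oplus> a"

lemma val_pair [simp]: "val e (pair s t) = pr (val e s) (val e t)"
  by (simp add: pair_def pr_def)

text \<open>
  With \<open>s = a + b\<close>, the code of \<open>(a, b)\<close> is at most \<open>s\<^sup>2 + s\<close>, which is less than \<open>(s + 1)\<^sup>2\<close>. So the
  code determines \<open>s\<close>, and then \<open>a\<close> and \<open>b\<close>.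
\<close>

lemma pr_less:
  assumes "a \<oplus> b \<prec> a' \<oplus> b'"
  shows "pr a b \<prec> pr a' b'"
proof -
  define s where "s = a \<oplus> b"
  have "s \<oplus> \<one> \<preceq> a' \<oplus> b'" using assms by (metis less_add_one not_le s_def)
  then have "(s \<oplus> \<one>) \<otimes> (s \<oplus> \<one>) \<preceq> (a' \<oplus> b') \<otimes> (a' \<oplus> b')" by (intro mult_mono)
  moreover have "(s \<oplus> \<one>) \<otimes> (s \<oplus> \<one>) = (s \<otimes> s \<oplus> s) \<oplus> (s \<oplus> \<one>)"
    by (simp add: distrib_left distrib_right add.assoc)
  moreover have "s \<otimes> s \<oplus> a \<preceq> s \<otimes> s \<oplus> s" by (intro add_mono) (simp_all add: s_def le_add)
  moreover have "s \<otimes> s \<oplus> s \<prec> (s \<otimes> s \<oplus> s) \<oplus> (s \<oplus> \<one>)"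
    using le_add(1) by (metis add.assoc less_add_one)
  moreover have "(a' \<oplus> b') \<otimes> (a' \<oplus> b') \<preceq> pr a' b'" by (simp add: pr_def le_add)
  ultimately show ?thesis unfolding pr_def s_def[symmetric] by order
qed

lemma pr_inject [simp]: "pr a b = pr a' b' \<longleftrightarrow> a = a' \<and> b = b'"
proof
  assume eq: "pr a b = pr a' b'"
  then have "\<not> a \<oplus> b \<prec> a' \<oplus> b'" "\<not> a' \<oplus> b' \<prec> a \<oplus> b"
    using pr_less[of a b a' b'] pr_less[of a' b' a b] by auto
  then have *: "a \<oplus> b = a' \<oplus> b'" by order
  with eq have "a = a'" unfolding pr_def by simp
  with * show "a = a' \<and> b = b'" by simp
qed simp

lemma pr_mono: "a \<preceq> a' \<Longrightarrow> b \<preceq> b' \<Longrightarrow> pr a b \<preceq> pr a' b'"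
  unfolding pr_def by (intro add_mono mult_mono)

lemma fst_le_pr: "a \<preceq> pr a b"
  by (simp add: pr_def le_add)

lemma snd_le_pr: "b \<preceq> pr a b"
proof (cases "a \<oplus> b = \<zero>")
  case True
  then have "b \<preceq> \<zero>" using le_add(2)[of b a] by simp
  then show ?thesis using zero_le order.trans by blast
next
  case False
  then have "\<one> \<preceq> a \<oplus> b"
    using semiring_laws(16) zero_le le_less by metis
  then have "(a \<oplus> b) \<otimes> \<one> \<preceq> (a \<oplus> b) \<otimes> (a \<oplus> b)" by (intro mult_mono) simp_all
  then show ?thesis using le_add(2)[of b a] le_add(1)[of "(a \<oplus> b) \<otimes> (a \<oplus> b)" a]
    unfolding pr_def mult_1_right by order
qed

text \<open>
  Comprehension is available for formulas that have both a \<open>\<Sigma>\<close> and a \<open>\<Pi>\<close> form; a bounded formula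
  acquires both by a dummy quantifier over a variable that is not free in it.
\<close>

lemma delta_comprehension:
  assumes "Delta00 \<theta>" "range E \<subseteq> Sets"
  shows "{a. sat (e(x := a)) E \<theta>} \<in> Sets"
proof -
  obtain w where w: "w \<notin> insert x (freeN \<theta>)" using fresh_string[of "insert x (freeN \<theta>)"] by auto
  obtain X where X: "X \<notin> freeS \<theta>" using fresh_string[of "freeS \<theta>"] by auto
  have dummy: "sat (e(x := a, w := b)) (E(X := A)) \<theta> \<longleftrightarrow> sat (e(x := a)) E \<theta>"
    "sat (e(x := a, w := b)) E \<theta> \<longleftrightarrow> sat (e(x := a)) E \<theta>" for a b A
    using w X by (intro sat_cong; auto)+
  have "(\<^bold>\<forall>x. (\<^bold>\<exists>w. \<theta>) \<^bold>\<longleftrightarrow> (\<^bold>\<forall>w. \<theta>)) \<^bold>\<longrightarrow> (\<^bold>\<exists>\<^sup>2X. \<^bold>\<forall>x. Var x \<^bold>\<in> X \<^bold>\<longleftrightarrow> (\<^bold>\<exists>w. \<theta>)) \<in> RCA0"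
    unfolding RCA0_def Delta01_comprehension_def Sigma01_def Pi01_def using assms(1) X by fastforce
  from RCA0[OF this assms(2), of e] have "\<exists>A\<in>Sets. \<forall>a. a \<in> A \<longleftrightarrow> sat (e(x := a)) E \<theta>"
    unfolding iff_conv_conj_imp using dummy by auto
  then obtain A where "A \<in> Sets" "\<forall>a. a \<in> A \<longleftrightarrow> sat (e(x := a)) E \<theta>" by blast
  then have "A = {a. sat (e(x := a)) E \<theta>}" by blast
  with \<open>A \<in> Sets\<close> show ?thesis by simp
qed

lemma UNIV_in_Sets: "UNIV \<in> Sets"
proof -
  obtain A where "A \<in> Sets" using Sets_nonempty by blast
  have "UNIV = {a. sat ((\<lambda>_. \<zero>)(''x'' := a)) (\<lambda>_. A) (\<^bold>0 \<^bold>= \<^bold>0)}" by simp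
  also have "\<dots> \<in> Sets" using \<open>A \<in> Sets\<close> by (intro delta_comprehension) (auto intro: Delta00.intros)
  finally show ?thesis .
qed

lemma set_induction:
  assumes "A \<in> Sets" "\<zero> \<in> A" "\<And>a. a \<in> A \<Longrightarrow> a \<oplus> \<one> \<in> A"
  shows "a \<in> A"
proof -
  let ?\<phi> = "\<^bold>\<exists>''w''. Var ''x'' \<^bold>\<in> ''A''"
  have "Sigma01 ?\<phi>" unfolding Sigma01_def by (blast intro: Delta00.intros)
  then have "substN ''x'' \<^bold>0 ?\<phi> \<^bold>\<and> (\<^bold>\<forall>''x''. ?\<phi> \<^bold>\<longrightarrow> substN ''x'' (Var ''x'' \<^bold>+ \<^bold>1) ?\<phi>) \<^bold>\<longrightarrow> (\<^bold>\<forall>''x''. ?\<phi>) \<in> RCA0"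
    unfolding RCA0_def Sigma01_induction_def by blast
  from RCA0[OF this, of "\<lambda>_. A"] assms show ?thesis by auto
qed

text \<open>
  Set induction for the numbers below which \<open>A\<close> has no element.
\<close>

lemma least_element:
  assumes "A \<in> Sets" "a \<in> A"
  obtains m where "m \<in> A" "\<And>k. k \<prec> m \<Longrightarrow> k \<notin> A"
proof -
  let ?\<theta> = "AllB ''k'' (Var ''x'') (\<^bold>\<not> Var ''k'' \<^bold>\<in> ''A'')"
  have "{b. \<forall>k. k \<prec> b \<longrightarrow> k \<notin> A} = {b. sat ((\<lambda>_. \<zero>)(''x'' := b)) (\<lambda>_. A) ?\<theta>}"
    by simp
  also have "\<dots> \<in> Sets" using assms by (intro delta_comprehension) (auto intro!: Delta00_intros)
  finally have B: "{b. \<forall>k. k \<prec> b \<longrightarrow> k \<notin> A} \<in> Sets" .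
  note found = that
  show thesis
  proof (rule ccontr)
    assume "\<not> thesis"
    then have no: "\<exists>k. k \<prec> m \<and> k \<in> A" if "m \<in> A" for m using that found \<open>\<not> thesis\<close> by blast
    have "a \<oplus> \<one> \<in> {b. \<forall>k. k \<prec> b \<longrightarrow> k \<notin> A}"
      by (rule set_induction[OF B]) (auto simp: le_less dest: no)
    with assms(2) show False by auto
  qed
qed

definition bounded :: "'a set \<Rightarrow> bool" where
  "bounded A \<longleftrightarrow> (\<exists>m. \<forall>a\<in>A. a \<prec> m)"

lemma boundedI: "(\<And>a. a \<in> A \<Longrightarrow> a \<preceq> m) \<Longrightarrow> bounded A"
  unfolding bounded_def by (rule exI[of _ "m \<oplus> \<one>"]) simp

lemma bounded_subset: "bounded B \<Longrightarrow> A \<subseteq> B \<Longrightarrow> bounded A"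
  unfolding bounded_def by blast

lemma bounded_insert: "bounded A \<Longrightarrow> bounded (insert a A)"
proof -
  assume "bounded A"
  then obtain m where m: "\<And>b. b \<in> A \<Longrightarrow> b \<prec> m" unfolding bounded_def by blast
  have "a \<prec> a \<oplus> \<one>" by simp
  with m have "\<forall>b\<in>insert a A. b \<prec> max m (a \<oplus> \<one>)" unfolding less_max_iff_disj by blast
  then show ?thesis unfolding bounded_def by blast
qed

definition poset :: "'a set \<Rightarrow> 'a set \<Rightarrow> bool" where
  "poset P R \<longleftrightarrow> (\<forall>r\<in>R. \<exists>a\<in>P. \<exists>b\<in>P. r = pr a b) \<and> (\<forall>a\<in>P. pr a a \<in> R) \<and>
    (\<forall>a b. pr a b \<in> R \<and> pr b a \<in> R \<longrightarrow> a = b) \<and>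
    (\<forall>a b c. pr a b \<in> R \<and> pr b c \<in> R \<longrightarrow> pr a c \<in> R)"

lemma posetD:
  assumes "poset P R"
  shows "r \<in> R \<Longrightarrow> \<exists>a\<in>P. \<exists>b\<in>P. r = pr a b" "a \<in> P \<Longrightarrow> pr a a \<in> R"
    "pr a b \<in> R \<Longrightarrow> pr b a \<in> R \<Longrightarrow> a = b" "pr a b \<in> R \<Longrightarrow> pr b c \<in> R \<Longrightarrow> pr a c \<in> R"
    "pr a b \<in> R \<Longrightarrow> a \<in> P \<and> b \<in> P"
proof -
  note P = assms[unfolded poset_def]
  show dom: "r \<in> R \<Longrightarrow> \<exists>a\<in>P. \<exists>b\<in>P. r = pr a b" for r using P by (elim conjE) (rule bspec)
  show "a \<in> P \<Longrightarrow> pr a a \<in> R" using P by (elim conjE) (rule bspec)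
  show "pr a b \<in> R \<Longrightarrow> pr b a \<in> R \<Longrightarrow> a = b" using P by (elim conjE) metis
  show "pr a b \<in> R \<Longrightarrow> pr b c \<in> R \<Longrightarrow> pr a c \<in> R" using P by (elim conjE) metis
  show "pr a b \<in> R \<Longrightarrow> a \<in> P \<and> b \<in> P" using dom[of "pr a b"] by auto
qed

definition two_sided_finite :: "'a set \<Rightarrow> 'a set \<Rightarrow> bool" where
  "two_sided_finite P R \<longleftrightarrow>
    (\<forall>a\<in>P. bounded {b. pr b a \<in> R \<and> b \<noteq> a} \<or> bounded {b. pr a b \<in> R \<and> a \<noteq> b})"

definition linear_ext :: "'a set \<Rightarrow> 'a set \<Rightarrow> 'a set \<Rightarrow> bool" where
  "linear_ext P R L \<longleftrightarrow> poset P L \<and> (\<forall>a\<in>P. \<forall>b\<in>P. pr a b \<in> L \<or> pr b a \<in> L) \<and>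
    (\<forall>a b. pr a b \<in> R \<longrightarrow> pr a b \<in> L)"

definition linearizable :: bool where
  "linearizable \<longleftrightarrow> (\<forall>P\<in>Sets. \<forall>R\<in>Sets. poset P R \<and> two_sided_finite P R \<longrightarrow>
    (\<exists>L\<in>Sets. linear_ext P R L \<and> two_sided_finite P L))"

lemma sat_linearizable: "sat e E omega_omega_star_linearizable \<longleftrightarrow> linearizable"
proof -
  have po: "sat e E (partial_order P R) \<longleftrightarrow> poset (E P) (E R)" for e E P R
    by (simp add: partial_order_def leq_def Let_def poset_def) blast
  have tf: "sat e E (omega_omega_star_like P R) \<longleftrightarrow> two_sided_finite (E P) (E R)" for e E P R
    by (simp add: omega_omega_star_like_def finitely_many_def lt_def leq_def Let_def
        two_sided_finite_def bounded_def) blast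
  have le: "sat e E (linear_extension P R L) \<longleftrightarrow> linear_ext (E P) (E R) (E L)" for e E P R L
    by (simp add: linear_extension_def linear_order_def leq_def Let_def linear_ext_def po) blast
  show ?thesis
    unfolding omega_omega_star_linearizable_def linearizable_def
    by (simp add: po tf le)
qed


section \<open>A partial order that decides a projection\<close>

primrec tg :: "nat \<Rightarrow> 'a" where
  "tg 0 = \<zero>"
| "tg (Suc n) = tg n \<oplus> \<one>"

declare tg.simps [simp del]

lemma val_num [simp]: "val e (num n) = tg n"
  by (induction n) (auto simp: tg.simps)

lemma tg_less: "m < n \<Longrightarrow> tg m \<prec> tg n"
proof (induction n)
  case (Suc n)
  then have "tg m \<preceq> tg n" by (cases "m = n") (simp_all add: le_less)
  then show ?case by (simp add: tg.simps)
qed simp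

lemma tg_eq [simp]: "tg m = tg n \<longleftrightarrow> m = n"
  using tg_less[of m n] tg_less[of n m] by (metis less_irrefl linorder_neqE_nat)

lemma tg_le [simp]: "tg m \<preceq> tg n \<longleftrightarrow> m \<le> n"
  using tg_less[of m n] tg_less[of n m] by (metis le_less linorder_not_less order_le_less tg_eq leD)

text \<open>
  Points are pairs of an index and a tag, and \<open>K n i\<close> says that \<open>n\<close> has been enumerated before
  stage \<open>i\<close>. In the notation of the introduction, tag 1 marks the points \<open>x_n\<close> and tag 4 the points
  \<open>y_n\<close>. Stage \<open>i\<close> adds four points: the one with tag 0 may go below \<open>x_n\<close> and the one with tag 2 above it,
  while the ones with tags 3 and 5 play these roles for \<open>y_n\<close>.
  Different tags are used for the two sides because a single stage point above one
  \<open>x_n\<close> and below another would make the order on the \<open>x_n\<close> depend on which of them are ever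
  enumerated. The rules without \<open>K\<close> are forced by transitivity, in a form that does not
  mention \<open>n\<close>. Tags 3 to 5 are the dual of tags 0 to 2.
\<close>

inductive below :: "('a \<Rightarrow> 'a \<Rightarrow> bool) \<Rightarrow> 'a \<Rightarrow> 'a \<Rightarrow> bool" for K where
  "\<not> K n i \<Longrightarrow> below K (pr i (tg 0)) (pr n (tg 1))"
| "K n i \<Longrightarrow> below K (pr n (tg 1)) (pr i (tg 2))"
| "i \<prec> j \<Longrightarrow> below K (pr i (tg 0)) (pr j (tg 2))"
| "K n i \<Longrightarrow> below K (pr i (tg 3)) (pr n (tg 4))"
| "\<not> K n i \<Longrightarrow> below K (pr n (tg 4)) (pr i (tg 5))"
| "i \<prec> j \<Longrightarrow> below K (pr j (tg 3)) (pr i (tg 5))"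

definition order_of :: "('a \<Rightarrow> 'a \<Rightarrow> bool) \<Rightarrow> 'a set" where
  "order_of K = {pr a b | a b. a = b \<or> below K a b}"

lemma pr_in_order_of: "pr a b \<in> order_of K \<longleftrightarrow> a = b \<or> below K a b"
  by (auto simp: order_of_def)

lemma below_irrefl: "\<not> below K a a"
  by (auto elim!: below.cases)

text \<open>
  The only chains of length two are those with tags 0, 1, 2 and 3, 4, 5. For the former, if \<open>n\<close> is not
  enumerated before \<open>i\<close> but is enumerated before \<open>j\<close>, then \<open>i \<prec> j\<close> because \<open>K\<close> is monotone in the stage.
\<close>

lemma poset_order_of:
  assumes "\<And>n i j. K n i \<Longrightarrow> i \<preceq> j \<Longrightarrow> K n j"
  shows "poset UNIV (order_of K)"
proof -
  have "below K a c" if "below K a b" "below K b c" for a b c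
    using that(1)
  proof cases
    case (1 n i)
    with that(2) show ?thesis
      using assms by (auto elim!: below.cases intro!: below.intros simp: not_le[symmetric])
  next
    case (4 n i)
    with that(2) show ?thesis
      using assms by (auto elim!: below.cases intro!: below.intros simp: not_le[symmetric])
  qed (use that(2) in \<open>auto elim!: below.cases\<close>)
  then show ?thesis
    unfolding poset_def pr_in_order_of using below_irrefl by (fastforce simp: order_of_def)
qed

lemma order_of_preds: "{b. pr b a \<in> order_of K \<and> b \<noteq> a} = {b. below K b a}"
  "{b. pr a b \<in> order_of K \<and> a \<noteq> b} = {b. below K a b}"
  by (auto simp: pr_in_order_of below_irrefl)

text \<open>
  The interesting case is that of \<open>x_n\<close>, and dually \<open>y_n\<close>. If \<open>K n j\<close>, then only stage points with
  index at most \<open>j\<close> were put below \<open>x_n\<close>; if there is no such \<open>j\<close>, nothing is above \<open>x_n\<close>. Points with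
  tag 0 are minimal; those with tag 3 have only points of smaller index above them; those with tags 2 and 5, as all
  numbers that code no tagged point, are maximal.
\<close>

lemma two_sided_finite_order_of:
  assumes mono: "\<And>n i j. K n i \<Longrightarrow> i \<preceq> j \<Longrightarrow> K n j" and lt: "\<And>n i. K n i \<Longrightarrow> n \<prec> i"
  shows "two_sided_finite UNIV (order_of K)"
  unfolding two_sided_finite_def order_of_preds
proof
  fix a
  have lt': "n \<preceq> i" if "K n i" for n i using lt[OF that] by simp
  have none: "bounded {}" by (simp add: bounded_def)
  have mono': "i \<preceq> j" if "\<not> K n i" "K n j" for n i j using mono[of n j i] that by (meson linear)
  consider n where "a = pr n (tg 0)" | n where "a = pr n (tg 1)" | n where "a = pr n (tg 3)"
    | n where "a = pr n (tg 4)" | "\<And>b. \<not> below K a b"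
    by (cases "\<exists>b. below K a b") (auto elim!: below.cases)
  then show "bounded {b. below K b a} \<or> bounded {b. below K a b}"
  proof cases
    case 1
    then have "{b. below K b a} = {}" by (auto elim: below.cases)
    then show ?thesis by (simp add: none)
  next
    case 2
    show ?thesis
    proof (cases "\<exists>i. K n i")
      case True
      then obtain j where j: "K n j" ..
      then have "bounded {b. below K b a}"
        by (intro boundedI[of _ "pr j (tg 0)"]) (auto elim!: below.cases simp: 2 intro!: pr_mono mono'[OF _ j])
      then show ?thesis ..
    next
      case False
      then have "{b. below K a b} = {}" by (auto elim: below.cases simp: 2)
      then show ?thesis by (simp add: none)
    qed
  next
    case 3
    have "bounded {b. below K a b}"
      by (intro boundedI[of _ "pr n (tg 5)"]) (auto elim!: below.cases simp: 3 intro!: pr_mono dest: lt')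
    then show ?thesis ..
  next
    case 4
    show ?thesis
    proof (cases "\<exists>i. K n i")
      case True
      then obtain j where j: "K n j" ..
      then have "bounded {b. below K a b}"
        by (intro boundedI[of _ "pr j (tg 5)"]) (auto elim!: below.cases simp: 4 intro!: pr_mono mono'[OF _ j])
      then show ?thesis ..
    next
      case False
      then have "{b. below K b a} = {}" by (auto elim: below.cases simp: 4)
      then show ?thesis by (simp add: none)
    qed
  next
    case 5
    then have "{b. below K a b} = {}" by auto
    then show ?thesis by (simp add: none)
  qed
qed

text \<open>
  Bounding both the witness and \<open>n\<close> by the stage makes the relation decidable and keeps finite the
  number of \<open>n\<close> enumerated before a given stage.
\<close>

definition entered :: "'a set \<Rightarrow> 'a \<Rightarrow> 'a \<Rightarrow> bool" where
  "entered X n i \<longleftrightarrow> n \<prec> i \<and> (\<exists>s. s \<prec> i \<and> pr s n \<in> X)"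

text \<open>
  Codes of pairs dominate their components, so every quantifier in the definition of the order can be
  bounded and comprehension for bounded formulas applies.
\<close>

lemma order_of_in_Sets:
  assumes X: "X \<in> Sets"
  shows "order_of (entered X) \<in> Sets"
proof -
  define C where "C = (\<lambda>a b i j.
    a = pr i (tg 0) \<and> b = pr j (tg 1) \<and> \<not> entered X j i \<or>
    a = pr i (tg 1) \<and> b = pr j (tg 2) \<and> entered X i j \<or>
    a = pr i (tg 0) \<and> b = pr j (tg 2) \<and> i \<prec> j \<or>
    a = pr i (tg 3) \<and> b = pr j (tg 4) \<and> entered X j i \<or>
    a = pr i (tg 4) \<and> b = pr j (tg 5) \<and> \<not> entered X i j \<or>
    a = pr i (tg 3) \<and> b = pr j (tg 5) \<and> j \<prec> i)"
  have below: "below (entered X) a b \<longleftrightarrow> (\<exists>i j. C a b i j)" for a b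
    unfolding below.simps[of _ a b] C_def by blast
  have C_le: "i \<preceq> pr a b \<and> j \<preceq> pr a b" if "C a b i j" for a b i j
  proof -
    have "i \<preceq> a" "j \<preceq> b" using that unfolding C_def by (elim disjE conjE; simp add: fst_le_pr)+
    then show ?thesis using fst_le_pr[of a b] snd_le_pr[of b a] order.trans by blast
  qed
  let ?v = "\<lambda>c. Var [c]"
  let ?ent = "\<lambda>n i. ?v n \<^bold>< ?v i \<^bold>\<and> ExB ''s'' (?v i) (pair (?v CHR ''s'') (?v n) \<^bold>\<in> ''X'')"
  let ?case = "\<lambda>k l \<chi>. ?v CHR ''a'' \<^bold>= pair (?v CHR ''i'') (num k) \<^bold>\<and>
    ?v CHR ''b'' \<^bold>= pair (?v CHR ''j'') (num l) \<^bold>\<and> \<chi>"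
  \<comment> \<open>a constant rather than an abbreviation, so that the simplifier evaluates it only through fact \<open>C\<close>\<close>
  define \<chi> where "\<chi> = (?case 0 1 (\<^bold>\<not> ?ent CHR ''j'' CHR ''i'') \<^bold>\<or> ?case 1 2 (?ent CHR ''i'' CHR ''j'') \<^bold>\<or>
    ?case 0 2 (?v CHR ''i'' \<^bold>< ?v CHR ''j'') \<^bold>\<or> ?case 3 4 (?ent CHR ''j'' CHR ''i'') \<^bold>\<or>
    ?case 4 5 (\<^bold>\<not> ?ent CHR ''i'' CHR ''j'') \<^bold>\<or> ?case 3 5 (?v CHR ''j'' \<^bold>< ?v CHR ''i''))"
  let ?p1 = "?v CHR ''p'' \<^bold>+ \<^bold>1"
  let ?\<theta> = "ExB ''a'' ?p1 (ExB ''b'' ?p1 (?v CHR ''p'' \<^bold>= pair (?v CHR ''a'') (?v CHR ''b'') \<^bold>\<and>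
    (?v CHR ''a'' \<^bold>= ?v CHR ''b'' \<^bold>\<or> ExB ''i'' ?p1 (ExB ''j'' ?p1 \<chi>))))"
  have C: "sat e E \<chi> \<longleftrightarrow> C (e ''a'') (e ''b'') (e ''i'') (e ''j'')" if "E ''X'' = X" for e E
    unfolding \<chi>_def sat_Or sat_And sat_ExB by (simp add: that C_def entered_def del: num.simps)
  have mem: "p \<in> order_of (entered X) \<longleftrightarrow> (\<exists>a. a \<preceq> p \<and> (\<exists>b. b \<preceq> p \<and> p = pr a b \<and>
      (a = b \<or> (\<exists>i. i \<preceq> p \<and> (\<exists>j. j \<preceq> p \<and> C a b i j)))))" (is "_ \<longleftrightarrow> ?bounded") for p
  proof
    assume "p \<in> order_of (entered X)"
    then obtain a b where p: "p = pr a b" "a = b \<or> (\<exists>i j. C a b i j)"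
      unfolding order_of_def below by blast
    then have "a = b \<or> (\<exists>i. i \<preceq> p \<and> (\<exists>j. j \<preceq> p \<and> C a b i j))" using C_le by blast
    then show ?bounded using p(1) fst_le_pr snd_le_pr by blast
  next
    assume ?bounded
    then show "p \<in> order_of (entered X)" unfolding order_of_def below by blast
  qed
  have sat_\<theta>: "sat ((\<lambda>_. \<zero>)(''p'' := p)) (\<lambda>_. X) ?\<theta> \<longleftrightarrow> (\<exists>a. a \<preceq> p \<and> (\<exists>b. b \<preceq> p \<and> p = pr a b \<and>
      (a = b \<or> (\<exists>i. i \<preceq> p \<and> (\<exists>j. j \<preceq> p \<and> C a b i j)))))" for p
    unfolding sat_ExB sat_And sat_Or by (simp add: C)
   have "order_of (entered X) = {p. sat ((\<lambda>_. \<zero>)(''p'' := p)) (\<lambda>_. X) ?\<theta>}"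
    unfolding set_eq_iff mem_Collect_eq mem sat_\<theta> by (rule allI) (rule refl)
  also have "\<dots> \<in> Sets"
    using X by (intro delta_comprehension) (auto intro!: Delta00_intros simp: pair_def \<chi>_def)
  finally show ?thesis .
qed

lemma unboundedI_above: 
  assumes "\<And>m. i \<preceq> m \<Longrightarrow> pr m (tg k) \<in> A"
  shows "\<not> bounded A"
proof
  assume "bounded A"
  then obtain m where m: "\<And>a. a \<in> A \<Longrightarrow> a \<prec> m" unfolding bounded_def by blast
  have "pr (m \<oplus> i) (tg k) \<prec> m" by (intro m assms le_add)
  moreover have "m \<preceq> pr (m \<oplus> i) (tg k)" by (rule order.trans[OF le_add(1) fst_le_pr])
  ultimately show False by simp
qed

lemma unboundedI: "(\<And>m. pr m (tg k) \<in> A) \<Longrightarrow> \<not> bounded A"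
  by (rule unboundedI_above[of \<zero>])

text \<open>
  In the linear extension a point with infinitely many predecessors cannot lie before a point with
  infinitely many successors, for then it would have infinitely many on both sides. This settles the order of
  \<open>x_n\<close> and \<open>y_n\<close> in either case, in opposite ways.
\<close>

lemma projection_in_Sets:
  assumes linearizable and X: "X \<in> Sets"
  shows "{n. \<exists>s. pr s n \<in> X} \<in> Sets"
proof -
  let ?E = "entered X"
  have mono: "?E n j" if "?E n i" "i \<preceq> j" for n i j
    using that unfolding entered_def by (meson less_le_trans)
  have "poset UNIV (order_of ?E)" by (rule poset_order_of) (rule mono)
  moreover have "two_sided_finite UNIV (order_of ?E)"
    by (rule two_sided_finite_order_of) (erule mono, assumption, simp add: entered_def)
  ultimately obtain L where L: "L \<in> Sets" "linear_ext UNIV (order_of ?E) L" "two_sided_finite UNIV L"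
    using assms(1) UNIV_in_Sets order_of_in_Sets[OF X] unfolding linearizable_def by blast
  have ext: "pr a b \<in> L" if "below ?E a b" for a b
    using L(2) that unfolding linear_ext_def by (simp add: pr_in_order_of)
  have pos: "poset UNIV L" using L(2) by (simp add: linear_ext_def)
  have trans: "pr a c \<in> L" if "pr a b \<in> L" "pr b c \<in> L" for a b c
    using posetD(4)[OF pos that] .
  have antisym: "a = b" if "pr a b \<in> L" "pr b a \<in> L" for a b
    using posetD(3)[OF pos that] .
  have linear: "pr a b \<in> L \<or> pr b a \<in> L" for a b
    using L(2) unfolding linear_ext_def by (elim conjE) simp
  define preds succs where "preds = (\<lambda>a. {b. pr b a \<in> L \<and> b \<noteq> a})" and "succs = (\<lambda>a. {b. pr a b \<in> L \<and> a \<noteq> b})"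
  have fin: "bounded (preds a) \<or> bounded (succs a)" for a
    using L(3) by (simp add: two_sided_finite_def preds_def succs_def)
  have split: "pr a b \<notin> L" if "\<not> bounded (preds a)" "\<not> bounded (succs b)" "a \<noteq> b" for a b
  proof
    assume "pr a b \<in> L"
    then have "succs b \<subseteq> succs a"
      using trans[of a b] antisym[of a b] by (auto simp: succs_def)
    then show False using that bounded_subset fin by blast
  qed
  have below_preds: "below ?E a b \<Longrightarrow> a \<in> preds b" and below_succs: "below ?E a b \<Longrightarrow> b \<in> succs a" for a b
    using ext below_irrefl unfolding preds_def succs_def by auto
  have "(\<exists>s. pr s n \<in> X) \<longleftrightarrow> pr (pr n (tg 1)) (pr n (tg 4)) \<in> L" for n
  proof -
    let ?x = "pr n (tg 1)" and ?y = "pr n (tg 4)"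
    show ?thesis
    proof (cases "\<exists>s. pr s n \<in> X")
      case True
      then obtain s where "pr s n \<in> X" ..
      \<comment> \<open>a stage that exceeds both \<open>n\<close> and its witness\<close>
      then have "?E n ((n \<oplus> s) \<oplus> \<one>)"
        unfolding entered_def by (auto simp: le_add intro!: exI[of _ s])
      then have E: "?E n m" if "(n \<oplus> s) \<oplus> \<one> \<preceq> m" for m using that by (rule mono)
      have "\<not> bounded (succs ?x)"
        by (rule unboundedI_above[where k = 2]) (intro below_succs below.intros(2) E)
      moreover have "\<not> bounded (preds ?y)"
        by (rule unboundedI_above[where k = 3]) (intro below_preds below.intros(4) E)
      ultimately have "pr ?y ?x \<notin> L" by (intro split) simp_all
      with True linear show ?thesis by blast
    next
      case False
      then have E: "\<not> ?E n m" for m by (simp add: entered_def)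
      have "\<not> bounded (preds ?x)"
        by (rule unboundedI[where k = 0]) (intro below_preds below.intros(1) E)
      moreover have "\<not> bounded (succs ?y)"
        by (rule unboundedI[where k = 5]) (intro below_succs below.intros(5) E)
      ultimately have "pr ?x ?y \<notin> L" by (intro split) simp_all
      with False show ?thesis by simp
    qed
  qed
  then have "{n. \<exists>s. pr s n \<in> X} = {n. sat ((\<lambda>_. \<zero>)(''n'' := n)) (\<lambda>_. L)
      (pair (pair (Var ''n'') (num 1)) (pair (Var ''n'') (num 4)) \<^bold>\<in> ''L'')}"
    by (simp del: num.simps)
  also have "\<dots> \<in> Sets"
    using L(1) by (intro delta_comprehension) (auto intro!: Delta00_intros)
  finally show ?thesis .
qed

section \<open>Arithmetical comprehension from linear extensions\<close>

primrec code :: "'a list \<Rightarrow> 'a" where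
  "code [] = \<zero>"
| "code (a # as) = pr a (code as)"

primrec code_term :: "string list \<Rightarrow> trm" where
  "code_term [] = \<^bold>0"
| "code_term (z # zs) = pair (Var z) (code_term zs)"

lemma val_code_term [simp]: "val e (code_term zs) = code (map e zs)"
  by (induction zs) auto

lemma vars_code_term [simp]: "vars (code_term zs) = set zs"
  by (induction zs) (auto simp: pair_def)

lemma code_inject: "length as = length bs \<Longrightarrow> code as = code bs \<longleftrightarrow> as = bs"
  by (induction rule: list_induct2) auto

lemma le_code: "a \<in> set as \<Longrightarrow> a \<preceq> code as"
proof (induction as)
  case (Cons b as)
  then show ?case using fst_le_pr[of b "code as"] snd_le_pr[of "code as" b] order.trans by auto
qed simp

abbreviation ExBs :: "string list \<Rightarrow> trm \<Rightarrow> fm \<Rightarrow> fm" where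
  "ExBs zs t \<phi> \<equiv> foldr (\<lambda>z. ExB z t) zs \<phi>"

lemma Delta00_ExBs: "Delta00 \<phi> \<Longrightarrow> set zs \<inter> vars t = {} \<Longrightarrow> Delta00 (ExBs zs t \<phi>)"
  by (induction zs) (auto intro!: Delta00_intros)

lemma sat_ExBs:
  assumes "c \<notin> set zs"
  shows "sat e E (ExBs zs (Var c \<^bold>+ \<^bold>1) \<phi>) \<longleftrightarrow>
    (\<exists>e'. (\<forall>v. v \<notin> set zs \<longrightarrow> e' v = e v) \<and> (\<forall>v\<in>set zs. e' v \<preceq> e c) \<and> sat e' E \<phi>)"
  using assms
proof (induction zs arbitrary: e)
  case Nil
  have "(\<forall>v. e' v = e v) \<longleftrightarrow> e' = e" for e' by auto
  then show ?case by simp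
next
  case (Cons z zs)
  have "(e(z := a)) c = e c" for a using Cons.prems by simp
  then have ih: "sat (e(z := a)) E (ExBs zs (Var c \<^bold>+ \<^bold>1) \<phi>) \<longleftrightarrow>
    (\<exists>e'. (\<forall>v. v \<notin> set zs \<longrightarrow> e' v = (e(z := a)) v) \<and> (\<forall>v\<in>set zs. e' v \<preceq> e c) \<and> sat e' E \<phi>)" for a
    using Cons.IH[of "e(z := a)"] Cons.prems by (simp only: list.set insert_iff) blast
  have "sat e E (ExBs (z # zs) (Var c \<^bold>+ \<^bold>1) \<phi>) \<longleftrightarrow>
    (\<exists>a. a \<preceq> e c \<and> sat (e(z := a)) E (ExBs zs (Var c \<^bold>+ \<^bold>1) \<phi>))"
    using Cons.prems unfolding foldr.simps comp_def sat_ExB by simp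
  also have "\<dots> \<longleftrightarrow>
    (\<exists>a. a \<preceq> e c \<and> (\<exists>e'. (\<forall>v. v \<notin> set zs \<longrightarrow> e' v = (e(z := a)) v) \<and> (\<forall>v\<in>set zs. e' v \<preceq> e c) \<and> sat e' E \<phi>))"
    by (simp only: ih)
  also have "\<dots> \<longleftrightarrow> (\<exists>e'. (\<forall>v. v \<notin> set (z # zs) \<longrightarrow> e' v = e v) \<and> (\<forall>v\<in>set (z # zs). e' v \<preceq> e c) \<and> sat e' E \<phi>)"
    (is "?l \<longleftrightarrow> ?r")
  proof
    assume ?l
    then obtain a e' where e': "a \<preceq> e c" "\<forall>v. v \<notin> set zs \<longrightarrow> e' v = (e(z := a)) v"
      "\<forall>v\<in>set zs. e' v \<preceq> e c" "sat e' E \<phi>" by blast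
    then have "e' z \<preceq> e c" by (cases "z \<in> set zs") auto
    with e' show ?r by (intro exI[of _ e']) auto
  next
    assume ?r
    then obtain e' where e': "\<forall>v. v \<notin> set (z # zs) \<longrightarrow> e' v = e v" "\<forall>v\<in>set (z # zs). e' v \<preceq> e c" "sat e' E \<phi>"
      by blast
    then show ?l by (intro exI[of _ "e' z"] conjI exI[of _ e']) auto
  qed
  finally show ?case .
qed

text \<open>
  A predicate on assignments that depends on the listed variables only is reduced to membership of one
  number in one set of the structure. In this form a number quantifier becomes
  a projection. Numbers that are not codes are unconstrained, so implication is
  represented by a Boolean combination.
\<close>

definition represented :: "string list \<Rightarrow> ((string \<Rightarrow> 'a) \<Rightarrow> bool) \<Rightarrow> bool" where
  "represented zs P \<longleftrightarrow> (\<exists>X\<in>Sets. \<forall>e. P e \<longleftrightarrow> code (map e zs) \<in> X)"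

text \<open>
  Decoding is done by bounded search, since the members of a list do not exceed its code.
\<close>

lemma represented_Delta00:
  assumes "Delta00 \<theta>" "range E \<subseteq> Sets" "freeN \<theta> \<subseteq> set zs"
  shows "represented zs (\<lambda>e. sat e E \<theta>)"
proof -
  obtain c where c: "c \<notin> set zs" using fresh_string[of "set zs"] by auto
  let ?\<theta> = "ExBs zs (Var c \<^bold>+ \<^bold>1) (Var c \<^bold>= code_term zs \<^bold>\<and> \<theta>)"
  let ?X = "{a. sat ((\<lambda>_. \<zero>)(c := a)) E ?\<theta>}"
  have "?X \<in> Sets"
  proof (rule delta_comprehension[OF Delta00_ExBs])
    show "Delta00 (Var c \<^bold>= code_term zs \<^bold>\<and> \<theta>)" by (intro Delta00_intros assms(1))
  qed (use assms(2) c in auto)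
  moreover have "sat e E \<theta> \<longleftrightarrow> code (map e zs) \<in> ?X" for e
  proof -
    \<comment> \<open>the search changes \<open>?d\<close> on \<open>zs\<close> only, and has to find \<open>?e\<close>\<close>
    let ?d = "(\<lambda>_. \<zero>)(c := code (map e zs))"
    let ?e = "\<lambda>v. if v \<in> set zs then e v else ?d v"
    have *: "sat e' E \<theta> \<longleftrightarrow> sat e E \<theta>" if "\<forall>v\<in>set zs. e' v = e v" for e'
      using that assms(3) by (intro sat_cong) auto
    have X: "code (map e zs) \<in> ?X \<longleftrightarrow> (\<exists>e'. (\<forall>v. v \<notin> set zs \<longrightarrow> e' v = ?d v) \<and>
       (\<forall>v\<in>set zs. e' v \<preceq> ?d c) \<and> e' c = code (map e' zs) \<and> sat e' E \<theta>)"
      unfolding mem_Collect_eq sat_ExBs[OF c] sat_And by simp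
    show "sat e E \<theta> \<longleftrightarrow> code (map e zs) \<in> ?X"
    proof
      assume \<theta>: "sat e E \<theta>"
      show "code (map e zs) \<in> ?X"
        unfolding X
      proof (intro exI[of _ ?e] conjI)
        show "\<forall>v\<in>set zs. ?e v \<preceq> ?d c" using le_code[of _ "map e zs"] by simp
        have "?e c = code (map e zs)" using c by simp
        also have "\<dots> = code (map ?e zs)" by (rule arg_cong[where f = code]) simp
        finally show "?e c = code (map ?e zs)" .
        have "sat ?e E \<theta> \<longleftrightarrow> sat e E \<theta>" by (rule *) simp
        with \<theta> show "sat ?e E \<theta>" by blast
      qed simp
    next
      assume "code (map e zs) \<in> ?X"
      then obtain e' where e': "e' c = code (map e zs)" "e' c = code (map e' zs)" "sat e' E \<theta>"
        unfolding X using c by auto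
      have "map e' zs = map e zs"
        using e'(1,2) code_inject[of "map e' zs" "map e zs"] by simp
      then have "\<forall>v\<in>set zs. e' v = e v" by simp
      from *[OF this] e'(3) show "sat e E \<theta>" by blast
    qed
  qed
  ultimately show ?thesis unfolding represented_def by blast
qed

text \<open>
  Membership of the code of the short list is itself a bounded formula.
\<close>

lemma represented_weaken:
  assumes "represented zs P" "set zs \<subseteq> set zs'"
  shows "represented zs' P"
proof -
  obtain X where X: "X \<in> Sets" "\<And>e. P e \<longleftrightarrow> code (map e zs) \<in> X"
    using assms(1) unfolding represented_def by blast
  have "represented zs' (\<lambda>e. sat e (\<lambda>_. X) (code_term zs \<^bold>\<in> ''X''))"
    using X(1) assms(2) by (intro represented_Delta00) (auto intro: Delta00.intros)
  moreover have "(\<lambda>e. sat e (\<lambda>_. X) (code_term zs \<^bold>\<in> ''X'')) = P"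
    by (rule ext) (simp add: X(2))
  ultimately show ?thesis by simp
qed

lemma represented_Imp:
  assumes "represented zs P" "represented zs Q"
  shows "represented zs (\<lambda>e. P e \<longrightarrow> Q e)"
proof -
  obtain X Y where X: "X \<in> Sets" "\<And>e. P e \<longleftrightarrow> code (map e zs) \<in> X"
    and Y: "Y \<in> Sets" "\<And>e. Q e \<longleftrightarrow> code (map e zs) \<in> Y"
    using assms unfolding represented_def by blast
  have "{a. a \<in> X \<longrightarrow> a \<in> Y} = {a. sat ((\<lambda>_. \<zero>)(''x'' := a)) ((\<lambda>_. X)(''Y'' := Y))
      (Var ''x'' \<^bold>\<in> ''X'' \<^bold>\<longrightarrow> Var ''x'' \<^bold>\<in> ''Y'')}" by simp
  also have "\<dots> \<in> Sets"
    using X(1) Y(1) by (intro delta_comprehension) (auto intro!: Delta00_intros)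
  finally show ?thesis unfolding represented_def by (rule rev_bexI) (simp add: X(2) Y(2))
qed

lemma represented_False: "represented zs (\<lambda>_. False)"
proof -
  obtain A where "A \<in> Sets" using Sets_nonempty by blast
  then have "represented zs (\<lambda>e. sat e (\<lambda>_. A) \<^bold>\<bottom>)"
    by (intro represented_Delta00) (auto intro: Delta00.intros)
  then show ?thesis by simp
qed

lemma represented_Not: "represented zs P \<Longrightarrow> represented zs (\<lambda>e. \<not> P e)"
  using represented_Imp[OF _ represented_False] by simp

lemma represented_Ex:
  assumes linearizable "represented (y # zs) P" "y \<notin> set zs"
  shows "represented zs (\<lambda>e. \<exists>a. P (e(y := a)))"
proof -
  obtain X where X: "X \<in> Sets" "\<And>e. P e \<longleftrightarrow> code (map e (y # zs)) \<in> X"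
    using assms(2) unfolding represented_def by blast
  have "P (e(y := a)) \<longleftrightarrow> pr a (code (map e zs)) \<in> X" for e a
    using assms(3) by (simp add: X(2))
  then show ?thesis
    unfolding represented_def by (intro rev_bexI[OF projection_in_Sets[OF assms(1) X(1)]]) simp
qed

lemma represented_arithmetical:
  assumes linearizable "arithmetical \<phi>" "range E \<subseteq> Sets" "freeN \<phi> \<subseteq> set zs"
  shows "represented zs (\<lambda>e. sat e E \<phi>)"
  using assms(2,4)
proof (induction \<phi> arbitrary: zs)
  case (AllN y \<phi>)
  \<comment> \<open>\<open>zs\<close> may contain the bound variable, which has to head the list\<close>
  let ?zs = "filter (\<lambda>z. z \<noteq> y) zs"
  have "represented (y # ?zs) (\<lambda>e. \<not> sat e E \<phi>)"
    using AllN by (intro represented_Not AllN.IH) auto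
  then have "represented ?zs (\<lambda>e. \<exists>a. \<not> sat (e(y := a)) E \<phi>)"
    using assms(1) by (intro represented_Ex) auto
  then have "represented ?zs (\<lambda>e. \<not> (\<exists>a. \<not> sat (e(y := a)) E \<phi>))"
    by (rule represented_Not)
  then show ?case using represented_weaken[of ?zs _ zs] by simp
next
  case (Imp \<phi> \<psi>)
  then show ?case by (simp add: represented_Imp)
qed (use assms(3) in \<open>auto intro!: represented_Delta00 Delta00.intros simp del: sat.simps\<close>)

lemma arithmetical_comprehension_from_linearizable:
  assumes linearizable "\<phi> \<in> arithmetical_comprehension" "range E \<subseteq> Sets"
  shows "sat e E \<phi>"
proof -
  obtain x X \<psi> where \<phi>: "\<phi> = (\<^bold>\<exists>\<^sup>2X. \<^bold>\<forall>x. Var x \<^bold>\<in> X \<^bold>\<longleftrightarrow> \<psi>)" "arithmetical \<psi>" "X \<notin> freeS \<psi>"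
    using assms(2) unfolding arithmetical_comprehension_def by blast
  obtain zs where zs: "set zs = freeN \<psi>" using finite_list[OF finite_freeN] by blast
  then obtain Y where Y: "Y \<in> Sets" "\<And>e. sat e E \<psi> \<longleftrightarrow> code (map e zs) \<in> Y"
    using represented_arithmetical[OF assms(1) \<phi>(2) assms(3), of zs] unfolding represented_def by auto
  define A where "A = {a. sat (e(x := a)) (\<lambda>_. Y) (code_term zs \<^bold>\<in> ''Y'')}"
  have "A \<in> Sets" unfolding A_def using Y(1) by (intro delta_comprehension) (auto intro: Delta00.intros)
  moreover have "sat (e(x := a)) (E(X := A)) \<psi> \<longleftrightarrow> a \<in> A" for a
  proof -
    have "sat (e(x := a)) (E(X := A)) \<psi> \<longleftrightarrow> sat (e(x := a)) E \<psi>"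
      using \<phi>(3) by (intro sat_cong) auto
    then show ?thesis by (simp add: Y(2) A_def)
  qed
  ultimately show ?thesis unfolding \<phi>(1) by (auto intro!: bexI[of _ A])
qed

end

section \<open>Linear extensions from arithmetical comprehension\<close>

locale aca0_model = rca0_model +
  assumes ACA: "\<phi> \<in> arithmetical_comprehension \<Longrightarrow> range E \<subseteq> Sets \<Longrightarrow> sat e E \<phi>"
begin

lemma comprehension:
  assumes "arithmetical \<phi>" "range E \<subseteq> Sets"
  shows "{a. sat (e(x := a)) E \<phi>} \<in> Sets"
proof -
  obtain X where X: "X \<notin> freeS \<phi>" using fresh_string[of "freeS \<phi>"] by auto
  then have "(\<^bold>\<exists>\<^sup>2X. \<^bold>\<forall>x. Var x \<^bold>\<in> X \<^bold>\<longleftrightarrow> \<phi>) \<in> arithmetical_comprehension"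
    using assms(1) unfolding arithmetical_comprehension_def by blast
  from ACA[OF this assms(2), of e] obtain A where A: "A \<in> Sets"
    "\<And>a. a \<in> A \<longleftrightarrow> sat (e(x := a)) (E(X := A)) \<phi>" by auto
  have "sat (e(x := a)) (E(X := A)) \<phi> \<longleftrightarrow> sat (e(x := a)) E \<phi>" for a
    using X by (intro sat_cong) auto
  then have "{a. sat (e(x := a)) E \<phi>} = A" using A(2) by blast
  with A(1) show ?thesis by simp
qed

text \<open>
  The lexicographic comparison of the sets of upper bounds in \<open>C\<close>, decided at the least difference.
  The element whose set contains it comes first, so that \<open>a \<le> b\<close>, which makes the set of \<open>a\<close> the larger
  one, puts \<open>a\<close> before \<open>b\<close>.
\<close>

definition lex :: "'a set \<Rightarrow> 'a set \<Rightarrow> 'a \<Rightarrow> 'a \<Rightarrow> bool" where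
  "lex C R a b \<longleftrightarrow> (\<exists>m. m \<in> C \<and> pr a m \<in> R \<and> pr b m \<notin> R \<and>
    (\<forall>k. k \<prec> m \<longrightarrow> k \<in> C \<longrightarrow> (pr a k \<in> R \<longleftrightarrow> pr b k \<in> R)))"

lemma lex_irrefl: "\<not> lex C R a a"
  by (auto simp: lex_def)

lemma lex_trans:
  assumes "lex C R a b" "lex C R b c"
  shows "lex C R a c"
proof -
  obtain m where m: "m \<in> C" "pr a m \<in> R" "pr b m \<notin> R"
    "\<And>k. k \<prec> m \<Longrightarrow> k \<in> C \<Longrightarrow> pr a k \<in> R \<longleftrightarrow> pr b k \<in> R"
    using assms(1) unfolding lex_def by blast
  obtain n where n: "n \<in> C" "pr b n \<in> R" "pr c n \<notin> R"
    "\<And>k. k \<prec> n \<Longrightarrow> k \<in> C \<Longrightarrow> pr b k \<in> R \<longleftrightarrow> pr c k \<in> R"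
    using assms(2) unfolding lex_def by blast
  consider "m \<prec> n" | "n \<prec> m" using m(3) n(2) by (metis neqE)
  then show ?thesis
  proof cases
    case 1
    then have "pr c m \<notin> R" using n(4) m by blast
    moreover have "pr a k \<in> R \<longleftrightarrow> pr c k \<in> R" if "k \<prec> m" "k \<in> C" for k
      using m(4)[OF that] n(4)[OF less_trans[OF that(1) 1] that(2)] by simp
    ultimately show ?thesis unfolding lex_def using m(1,2) by blast
  next
    case 2
    then have "pr a n \<in> R" using m(4) n by blast
    moreover have "pr a k \<in> R \<longleftrightarrow> pr c k \<in> R" if "k \<prec> n" "k \<in> C" for k
      using n(4)[OF that] m(4)[OF less_trans[OF that(1) 2] that(2)] by simp
    ultimately show ?thesis unfolding lex_def using n(1,3) by blast
  qed
qed

text \<open>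
  The sets of upper bounds of distinct \<open>a\<close> and \<open>b\<close> differ, namely at \<open>a\<close> or at \<open>b\<close>, by antisymmetry.
\<close>

lemma lex_total:
  assumes "C \<in> Sets" "R \<in> Sets" "poset P R" "C \<subseteq> P" "a \<in> C" "b \<in> C" "a \<noteq> b"
  shows "lex C R a b \<or> lex C R b a"
proof -
  let ?e = "(\<lambda>_. \<zero>)(''a'' := a, ''b'' := b)" and ?E = "(\<lambda>_. C)(''R'' := R)"
  let ?\<theta> = "Var ''k'' \<^bold>\<in> ''C'' \<^bold>\<and> \<^bold>\<not> (pair (Var ''a'') (Var ''k'') \<^bold>\<in> ''R'' \<^bold>\<longleftrightarrow> pair (Var ''b'') (Var ''k'') \<^bold>\<in> ''R'')"
  define D where "D = {k. k \<in> C \<and> (pr a k \<in> R) \<noteq> (pr b k \<in> R)}"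
  have "D = {k. sat (?e(''k'' := k)) ?E ?\<theta>}" by (auto simp: D_def)
  also have "\<dots> \<in> Sets" using assms(1,2) by (intro comprehension) auto
  finally have D: "D \<in> Sets" .
  have "a \<in> D \<or> b \<in> D" unfolding D_def using assms(4-7) posetD(2,3)[OF assms(3)] by blast
  then obtain m where m: "m \<in> D" "\<And>k. k \<prec> m \<Longrightarrow> k \<notin> D" using least_element[OF D] by metis
  have "pr a k \<in> R \<longleftrightarrow> pr b k \<in> R" if "k \<prec> m" "k \<in> C" for k
    using m(2)[OF that(1)] that(2) by (simp add: D_def)
  then show ?thesis using m(1) unfolding D_def lex_def by blast
qed

lemma lex_extends:
  assumes "C \<in> Sets" "R \<in> Sets" "poset P R" "C \<subseteq> P" "a \<in> C" "b \<in> C" "a \<noteq> b" "pr a b \<in> R"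
  shows "lex C R a b"
proof -
  have "\<not> lex C R b a" unfolding lex_def using posetD(4)[OF assms(3) assms(8)] by blast
  then show ?thesis using lex_total[OF assms(1-7)] by blast
qed

text \<open>
  Finitely many bounds have a common bound. In a structure whose numbers are nonstandard this is an
  induction, for a formula that is arithmetical but not bounded.
\<close>

lemma bounding:
  assumes C: "C \<in> Sets" and R: "R \<in> Sets" and fin: "\<And>m. m \<in> C \<Longrightarrow> bounded {b. pr b m \<in> R}"
  shows "\<exists>n. \<forall>m. m \<preceq> a \<longrightarrow> m \<in> C \<longrightarrow> (\<forall>b. pr b m \<in> R \<longrightarrow> b \<prec> n)"
proof -
  define D where "D = {a. \<exists>n. \<forall>m. m \<preceq> a \<longrightarrow> m \<in> C \<longrightarrow> (\<forall>b. pr b m \<in> R \<longrightarrow> b \<prec> n)}"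
  let ?E = "(\<lambda>_. C)(''R'' := R)"
  let ?\<theta> = "\<^bold>\<exists>''n''. \<^bold>\<forall>''m''. Var ''m'' \<^bold>< Var ''a'' \<^bold>+ \<^bold>1 \<^bold>\<longrightarrow> Var ''m'' \<^bold>\<in> ''C'' \<^bold>\<longrightarrow>
    (\<^bold>\<forall>''b''. pair (Var ''b'') (Var ''m'') \<^bold>\<in> ''R'' \<^bold>\<longrightarrow> Var ''b'' \<^bold>< Var ''n'')"
  have "D = {a. sat ((\<lambda>_. \<zero>)(''a'' := a)) ?E ?\<theta>}"
    unfolding D_def sat_ExN by simp
  also have "\<dots> \<in> Sets" using C R by (intro comprehension) auto
  finally have "D \<in> Sets" .
  have "bounded ({b. m \<in> C \<and> pr b m \<in> R})" for m
    using fin[of m] by (cases "m \<in> C") (auto simp: bounded_def)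
  then obtain f where f: "\<And>m b. m \<in> C \<Longrightarrow> pr b m \<in> R \<Longrightarrow> b \<prec> f m"
    unfolding bounded_def by (simp add: Ball_def) metis
  have "a \<in> D"
  proof (rule set_induction[OF \<open>D \<in> Sets\<close>])
    have "m = \<zero>" if "m \<preceq> \<zero>" for m using that by (auto simp: le_less)
    then show "\<zero> \<in> D" unfolding D_def using f by blast
  next
    fix a assume "a \<in> D"
    then obtain n where n: "\<And>m b. m \<preceq> a \<Longrightarrow> m \<in> C \<Longrightarrow> pr b m \<in> R \<Longrightarrow> b \<prec> n"
      unfolding D_def by blast
    have "b \<prec> max n (f (a \<oplus> \<one>))" if "m \<preceq> a \<oplus> \<one>" "m \<in> C" "pr b m \<in> R" for m b
    proof (cases "m = a \<oplus> \<one>")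
      case True
      then show ?thesis using f that by (simp add: less_max_iff_disj)
    next
      case False
      then have "m \<preceq> a" using that(1) by (simp add: le_less)
      then show ?thesis using n that by (simp add: less_max_iff_disj)
    qed
    then show "a \<oplus> \<one> \<in> D" unfolding D_def by blast
  qed
  then show ?thesis by (simp add: D_def)
qed

text \<open>
  Let \<open>b\<close> come before \<open>a\<close> because of the least difference \<open>m\<close>. If \<open>m\<close> does not exceed \<open>a\<close>, then \<open>b\<close> is among
  the finitely many lower bounds of \<open>m\<close>. Otherwise the sets of upper bounds agree at \<open>a\<close>, so \<open>b\<close> is a
  lower bound of \<open>a\<close>. A common bound for the numbers up to \<open>a\<close> therefore suffices.
\<close>

lemma lex_bounded:
  assumes "C \<in> Sets" "R \<in> Sets" "poset P R" "C \<subseteq> P" "a \<in> C"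
    and fin: "\<And>m. m \<in> C \<Longrightarrow> bounded {b. pr b m \<in> R}"
  shows "bounded {b. lex C R b a}"
proof -
  obtain n where n: "\<And>m b. m \<preceq> a \<Longrightarrow> m \<in> C \<Longrightarrow> pr b m \<in> R \<Longrightarrow> b \<prec> n"
    using bounding[OF assms(1,2) fin, of a] by blast
  have "b \<prec> n" if lex: "lex C R b a" for b
  proof -
    obtain m where m: "m \<in> C" "pr b m \<in> R" "\<And>k. k \<prec> m \<Longrightarrow> k \<in> C \<Longrightarrow> pr b k \<in> R \<longleftrightarrow> pr a k \<in> R"
      using lex unfolding lex_def by blast
    show ?thesis
    proof (cases "m \<preceq> a")
      case True
      then show ?thesis using n m by blast
    next
      case False
      then have "pr b a \<in> R" using m(3)[of a] assms(4,5) posetD(2)[OF assms(3)] by auto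
      then show ?thesis using n[of a] assms(5) by simp
    qed
  qed
  then show ?thesis unfolding bounded_def by blast
qed

lemma lex_in_Sets:
  assumes "C \<in> Sets" "R \<in> Sets"
  shows "{pr a b | a b. lex C R a b} \<in> Sets"
proof -
  let ?E = "(\<lambda>_. C)(''R'' := R)" and ?a = "Var ''a''" and ?b = "Var ''b''" and ?m = "Var ''m''" and ?k = "Var ''k''"
  define \<chi> where "\<chi> = (\<^bold>\<exists>''m''. ?m \<^bold>\<in> ''C'' \<^bold>\<and> pair ?a ?m \<^bold>\<in> ''R'' \<^bold>\<and> \<^bold>\<not> pair ?b ?m \<^bold>\<in> ''R'' \<^bold>\<and>
    (\<^bold>\<forall>''k''. ?k \<^bold>< ?m \<^bold>\<longrightarrow> ?k \<^bold>\<in> ''C'' \<^bold>\<longrightarrow> (pair ?a ?k \<^bold>\<in> ''R'' \<^bold>\<longleftrightarrow> pair ?b ?k \<^bold>\<in> ''R'')))"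
  have \<chi>: "sat e ?E \<chi> \<longleftrightarrow> lex C R (e ''a'') (e ''b'')" for e
    unfolding \<chi>_def sat_ExN sat_And lex_def by (simp add: iff_conv_conj_imp)
  have "{pr a b | a b. lex C R a b} = {p. sat ((\<lambda>_. \<zero>)(''p'' := p)) ?E
      (\<^bold>\<exists>''a''. \<^bold>\<exists>''b''. Var ''p'' \<^bold>= pair ?a ?b \<^bold>\<and> \<chi>)}"
    unfolding sat_ExN sat_And by (simp add: \<chi>)
  also have "\<dots> \<in> Sets" using assms by (intro comprehension) (auto simp: \<chi>_def)
  finally show ?thesis .
qed

lemma converse_in_Sets:
  assumes "R \<in> Sets"
  shows "{pr a b | a b. pr b a \<in> R} \<in> Sets"
proof -
  let ?a = "Var ''a''" and ?b = "Var ''b''"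
  have "{pr a b | a b. pr b a \<in> R} = {p. sat ((\<lambda>_. \<zero>)(''p'' := p)) (\<lambda>_. R)
      (\<^bold>\<exists>''a''. \<^bold>\<exists>''b''. Var ''p'' \<^bold>= pair ?a ?b \<^bold>\<and> pair ?b ?a \<^bold>\<in> ''R'')}"
    unfolding sat_ExN sat_And by simp
  also have "\<dots> \<in> Sets" using assms by (intro comprehension) auto
  finally show ?thesis .
qed

lemma two_sided_order_in_Sets:
  assumes "P \<in> Sets" "A \<in> Sets" "S \<in> Sets" "T \<in> Sets"
  shows "{pr a b | a b. a \<in> P \<and> b \<in> P \<and> (a = b \<or> (a \<in> A \<and> b \<notin> A) \<or> (a \<in> A \<and> b \<in> A \<and> pr a b \<in> S) \<or>
    (a \<notin> A \<and> b \<notin> A \<and> pr b a \<in> T))} \<in> Sets" (is "?L \<in> _")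
proof -
  let ?E = "(\<lambda>_. P)(''A'' := A, ''S'' := S, ''T'' := T)" and ?a = "Var ''a''" and ?b = "Var ''b''"
  have "?L = {p. sat ((\<lambda>_. \<zero>)(''p'' := p)) ?E (\<^bold>\<exists>''a''. \<^bold>\<exists>''b''. Var ''p'' \<^bold>= pair ?a ?b \<^bold>\<and>
    ?a \<^bold>\<in> ''P'' \<^bold>\<and> ?b \<^bold>\<in> ''P'' \<^bold>\<and> (?a \<^bold>= ?b \<^bold>\<or> (?a \<^bold>\<in> ''A'' \<^bold>\<and> \<^bold>\<not> ?b \<^bold>\<in> ''A'') \<^bold>\<or>
    (?a \<^bold>\<in> ''A'' \<^bold>\<and> ?b \<^bold>\<in> ''A'' \<^bold>\<and> pair ?a ?b \<^bold>\<in> ''S'') \<^bold>\<or>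
    (\<^bold>\<not> ?a \<^bold>\<in> ''A'' \<^bold>\<and> \<^bold>\<not> ?b \<^bold>\<in> ''A'' \<^bold>\<and> pair ?b ?a \<^bold>\<in> ''T'')))}"
    unfolding sat_ExN sat_And sat_Or by simp
  also have "\<dots> \<in> Sets" using assms by (intro comprehension) auto
  finally show ?thesis .
qed

text \<open>
  \<open>A\<close> comes before \<open>B\<close>; within \<open>A\<close> the order is lexicographic, and within \<open>B\<close> it is the reverse of the
  lexicographic order of the converse relation. Predecessors of a point of \<open>A\<close> are in \<open>A\<close>, and successors
  of a point of \<open>B\<close> are in \<open>B\<close>, where \<open>lex_bounded\<close> bounds them.
\<close>

lemma linearizable: linearizable
  unfolding linearizable_def
proof (intro ballI impI, elim conjE)
  fix P R
  assume P: "P \<in> Sets" and R: "R \<in> Sets" and po: "poset P R" and two: "two_sided_finite P R"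
  define A where "A = {a \<in> P. bounded {b. pr b a \<in> R}}"
  define B where "B = P - A"
  define R' where "R' = {pr a b | a b. pr b a \<in> R}"
  note refl = posetD(2)[OF po] and antisym = posetD(3)[OF po] and trans = posetD(4)[OF po] and dom = posetD(5)[OF po]
  have R'_iff: "pr a b \<in> R' \<longleftrightarrow> pr b a \<in> R" for a b by (auto simp: R'_def)
  have po': "poset P R'"
    unfolding poset_def R'_iff using dom refl antisym trans by (auto simp: R'_def)
  have A: "A \<in> Sets"
  proof -
    have "A = {a. sat ((\<lambda>_. \<zero>)(''a'' := a)) ((\<lambda>_. P)(''R'' := R)) (Var ''a'' \<^bold>\<in> ''P'' \<^bold>\<and>
      (\<^bold>\<exists>''m''. \<^bold>\<forall>''b''. pair (Var ''b'') (Var ''a'') \<^bold>\<in> ''R'' \<^bold>\<longrightarrow> Var ''b'' \<^bold>< Var ''m''))}"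
      unfolding A_def bounded_def sat_And sat_ExN by simp
    also have "\<dots> \<in> Sets" using P R by (intro comprehension) auto
    finally show ?thesis .
  qed
  have B: "B \<in> Sets"
  proof -
    have "B = {a. sat ((\<lambda>_. \<zero>)(''a'' := a)) ((\<lambda>_. P)(''A'' := A)) (Var ''a'' \<^bold>\<in> ''P'' \<^bold>\<and> \<^bold>\<not> Var ''a'' \<^bold>\<in> ''A'')}"
      unfolding B_def by auto
    also have "\<dots> \<in> Sets" using P A by (intro comprehension) auto
    finally show ?thesis .
  qed
  have R': "R' \<in> Sets" unfolding R'_def by (rule converse_in_Sets[OF R])
  have subset: "A \<subseteq> P" "B \<subseteq> P" by (auto simp: A_def B_def)
  have finA: "bounded {b. pr b a \<in> R}" if "a \<in> A" for a using that by (simp add: A_def)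
  have finB: "bounded {b. pr b a \<in> R'}" if "a \<in> B" for a
  proof -
    have "a \<in> P" "\<not> bounded {b. pr b a \<in> R}" using that by (auto simp: A_def B_def)
    moreover have "{b. pr b a \<in> R} \<subseteq> insert a {b. pr b a \<in> R \<and> b \<noteq> a}" by auto
    ultimately have "\<not> bounded {b. pr b a \<in> R \<and> b \<noteq> a}" using bounded_insert bounded_subset by blast
    then have "bounded {b. pr a b \<in> R \<and> a \<noteq> b}" using two \<open>a \<in> P\<close> unfolding two_sided_finite_def by blast
    then have "bounded (insert a {b. pr a b \<in> R \<and> a \<noteq> b})" by (rule bounded_insert)
    then show ?thesis by (rule bounded_subset) (auto simp: R'_iff)
  qed
  have down: "a \<in> A" if "pr a b \<in> R" "b \<in> A" for a b
  proof -
    have "{c. pr c a \<in> R} \<subseteq> {c. pr c b \<in> R}" using trans that(1) by blast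
    then show ?thesis using finA[OF that(2)] bounded_subset dom[OF that(1)] unfolding A_def by blast
  qed
  define before where "before = (\<lambda>a b. a \<in> A \<and> b \<in> B \<or> a \<in> A \<and> b \<in> A \<and> lex A R a b \<or> a \<in> B \<and> b \<in> B \<and> lex B R' b a)"
  define L where "L = {pr a b | a b. a \<in> P \<and> b \<in> P \<and> (a = b \<or> before a b)}"
  have L_iff: "pr a b \<in> L \<longleftrightarrow> a \<in> P \<and> b \<in> P \<and> (a = b \<or> before a b)" for a b
    by (auto simp: L_def)
  have "L = {pr a b | a b. a \<in> P \<and> b \<in> P \<and> (a = b \<or> (a \<in> A \<and> b \<notin> A) \<or>
    (a \<in> A \<and> b \<in> A \<and> pr a b \<in> {pr a b | a b. lex A R a b}) \<or>
    (a \<notin> A \<and> b \<notin> A \<and> pr b a \<in> {pr a b | a b. lex B R' a b}))}"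
    unfolding L_def before_def B_def by auto
  also have "\<dots> \<in> Sets"
    by (intro two_sided_order_in_Sets lex_in_Sets P A B R R')
  finally have L: "L \<in> Sets" .
  have disjoint: "a \<notin> B" if "a \<in> A" for a using that by (simp add: B_def)
  have irrefl: "\<not> before a a" for a
    using lex_irrefl disjoint unfolding before_def by blast
  have before_trans: "before a c" if "before a b" "before b c" for a b c
    using that lex_trans disjoint unfolding before_def by metis
  have total: "before a b \<or> before b a" if "a \<in> P" "b \<in> P" "a \<noteq> b" for a b
    using that lex_total[OF A R po subset(1), of a b] lex_total[OF B R' po' subset(2), of a b]
    unfolding before_def B_def by blast
  have extends: "before a b" if "pr a b \<in> R" "a \<noteq> b" for a b
  proof -
    have "a \<in> P" "b \<in> P" using dom[OF that(1)] by auto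
    moreover have "lex A R a b" if "a \<in> A" "b \<in> A"
      using lex_extends[OF A R po subset(1)] that \<open>pr a b \<in> R\<close> \<open>a \<noteq> b\<close> by blast
    moreover have "lex B R' b a" if "a \<in> B" "b \<in> B"
      using lex_extends[OF B R' po' subset(2)] that \<open>pr a b \<in> R\<close> \<open>a \<noteq> b\<close> R'_iff by blast
    ultimately show ?thesis using down[OF \<open>pr a b \<in> R\<close>] unfolding before_def B_def by blast
  qed
  have "poset P L"
    unfolding poset_def
  proof (intro conjI allI impI ballI)
    show "\<exists>a\<in>P. \<exists>b\<in>P. r = pr a b" if "r \<in> L" for r using that unfolding L_def by blast
    show "pr a a \<in> L" if "a \<in> P" for a using that by (simp add: L_iff)
    show "a = b" if "pr a b \<in> L \<and> pr b a \<in> L" for a b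
      using that before_trans[of a b a] irrefl[of a] by (auto simp: L_iff)
    show "pr a c \<in> L" if "pr a b \<in> L \<and> pr b c \<in> L" for a b c
      using that before_trans[of a b c] by (auto simp: L_iff)
  qed
  moreover have "pr a b \<in> L" if "pr a b \<in> R" for a b
    using dom[OF that] extends[OF that] by (auto simp: L_iff)
  ultimately have ext: "linear_ext P R L"
    unfolding linear_ext_def using total by (auto simp: L_iff)
  have "two_sided_finite P L"
    unfolding two_sided_finite_def
  proof
    fix a assume "a \<in> P"
    show "bounded {b. pr b a \<in> L \<and> b \<noteq> a} \<or> bounded {b. pr a b \<in> L \<and> a \<noteq> b}"
    proof (cases "a \<in> A")
      case True
      have "bounded {b. lex A R b a}" by (rule lex_bounded[OF A R po subset(1) True finA])
      moreover have "{b. pr b a \<in> L \<and> b \<noteq> a} \<subseteq> {b. lex A R b a}"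
        using True disjoint by (auto simp: L_iff before_def)
      ultimately show ?thesis using bounded_subset by blast
    next
      case False
      then have "a \<in> B" using \<open>a \<in> P\<close> by (simp add: B_def)
      then have "bounded {b. lex B R' b a}" by (rule lex_bounded[OF B R' po' subset(2) _ finB])
      moreover have "{b. pr a b \<in> L \<and> a \<noteq> b} \<subseteq> {b. lex B R' b a}"
        using False by (auto simp: L_iff before_def)
      ultimately show ?thesis using bounded_subset by blast
    qed
  qed
  with L ext show "\<exists>L\<in>Sets. linear_ext P R L \<and> two_sided_finite P L" by blast
qed

end

section \<open>The equivalence\<close>

theorem theorem3p4:
  shows "equivalent_over RCA0 ACA0 {omega_omega_star_linearizable}"
  unfolding equivalent_over_def
proof (intro conjI ballI)
  fix \<phi> assume "\<phi> \<in> {omega_omega_star_linearizable}"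
  then have \<phi>: "\<phi> = omega_omega_star_linearizable" by simp
  show "RCA0 \<union> ACA0 \<turnstile> \<phi>"
  proof (rule completeness)
    show "ordered_semiring_axioms \<subseteq> RCA0 \<union> ACA0" by (auto simp: RCA0_def)
    fix zero one add mult less and Sets :: "nat set set" and e and E :: "string \<Rightarrow> nat set"
    assume "Sets \<noteq> {}" and model: "\<And>\<psi> e E. \<psi> \<in> RCA0 \<union> ACA0 \<Longrightarrow> range E \<subseteq> Sets \<Longrightarrow>
      two_sorted_structure.sat zero one add mult less Sets e E \<psi>"
    then interpret aca0_model zero one add mult less Sets
      by unfold_locales (auto simp: ACA0_def)
    show "sat e E \<phi>" unfolding \<phi> sat_linearizable by (rule linearizable)
  qed
next
  fix \<phi> assume \<phi>: "\<phi> \<in> ACA0"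
  show "RCA0 \<union> {omega_omega_star_linearizable} \<turnstile> \<phi>"
  proof (rule completeness)
    show "ordered_semiring_axioms \<subseteq> RCA0 \<union> {omega_omega_star_linearizable}" by (auto simp: RCA0_def)
    fix zero one add mult less and Sets :: "nat set set" and e and E :: "string \<Rightarrow> nat set"
    assume "Sets \<noteq> {}" and model: "\<And>\<psi> e E. \<psi> \<in> RCA0 \<union> {omega_omega_star_linearizable} \<Longrightarrow>
      range E \<subseteq> Sets \<Longrightarrow> two_sorted_structure.sat zero one add mult less Sets e E \<psi>"
      and E: "range E \<subseteq> Sets"
    then interpret rca0_model zero one add mult less Sets
      by unfold_locales auto
    have "sat e E omega_omega_star_linearizable" by (rule model) (simp_all add: E)
    then have linearizable by (simp only: sat_linearizable)
    then show "sat e E \<phi>"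
      using \<phi> RCA0 E arithmetical_comprehension_from_linearizable unfolding ACA0_def by blast
  qed
qed

end
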